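(* Let $\Omega\subset\mathbb{R}^3$ be a bounded connected open set with $C^4$-smooth boundary, $T>0$, and $0<\alpha\le\beta$. Let $\{\rho_k\}_{k\in\mathbb{N}}$ be a sequence such that (A1) $\rho_k\in L^\infty([0,T];L^\infty(\Omega))$ and $\alpha\le\rho_k(t,x)\le\beta$ for a.e. $(t,x)$, for all $k$; (A2) $\{\rho_k\}_{k\in\mathbb{N}}$, $\rho_k:[0,T]\to L^2(\Omega)$, is weakly equi-continuous in the sense that for each $\phi\in C^\infty_0(\Omega)$ the family of functions $\{t\mapsto(\rho_k(t,\cdot),\phi)_{L^2(\Omega)}\}_{k\in\mathbb{N}}$ is equi-continuous on $[0,T]$. Then there exist a subsequence of $\{\rho_k\}_{k\in\mathbb{N}}$, still denoted by $\{\rho_k\}_{k\in\mathbb{N}}$, and a function $\rho\in L^\infty([0,T];L^\infty(\Omega))$ with $\alpha\le\rho\le\beta$ a.e. such that $$\rho_k(t,\cdot)\rightharpoonup\rho(t,\cdot)\quad\text{weakly in }L^2(\Omega)\text{ as }k\to\infty,\text{ for each }t\in[0,T].$$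
   Context: Each $\rho_k$ is regarded as a map defined at every $t\in[0,T]$ with values in $L^2(\Omega)$. $C^\infty_0(\Omega)$ denotes smooth real functions with compact support in $\Omega$. *)

theory Defs
  imports "HOL-Analysis.Analysis"
begin

text \<open>
  Continuous differentiability of order \<open>k\<close> on the whole space. In finite dimension,
  continuity of \<open>x \<mapsto> Df(x)\<close> is the same as continuity of \<open>x \<mapsto> Df(x) v\<close> for every
  direction \<open>v\<close>; testing each direction keeps the codomain type fixed in the recursion.
\<close>

primrec Ck :: "nat \<Rightarrow> ('a::euclidean_space \<Rightarrow> 'b::real_normed_vector) \<Rightarrow> bool" where
  "Ck 0 f \<longleftrightarrow> continuous_on UNIV f"
| "Ck (Suc k) f \<longleftrightarrow>
     (\<forall>x. f differentiable (at x)) \<and> (\<forall>v. Ck k (\<lambda>x. frechet_derivative f (at x) v))"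

text \<open>
  The boundary is of class \<open>C\<^sup>k\<close>: near each boundary point, in suitable orthonormal
  coordinates, the set is the region strictly above the graph of a \<open>C\<^sup>k\<close> function.
  The translation to the boundary point is absorbed into \<open>\<gamma>\<close>.
\<close>

definition Ck_boundary :: "nat \<Rightarrow> (real^3) set \<Rightarrow> bool" where
  "Ck_boundary k \<Omega> \<longleftrightarrow>
     (\<forall>p\<in>frontier \<Omega>. \<exists>r>0. \<exists>A::real^3 \<Rightarrow> real^3. \<exists>\<gamma>::real \<times> real \<Rightarrow> real.
        orthogonal_transformation A \<and> Ck k \<gamma> \<and>
        \<Omega> \<inter> ball p r = {x \<in> ball p r. A x $ 3 > \<gamma> (A x $ 1, A x $ 2)})"

text \<open>
  \<open>C\<^sub>0\<^sup>\<infinity>(\<Omega>)\<close>, each test function being identified with its extension by zero.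
\<close>

definition test_functions :: "'a::euclidean_space set \<Rightarrow> ('a \<Rightarrow> real) set" where
  "test_functions \<Omega> =
     {\<phi>. (\<forall>k. Ck k \<phi>) \<and> compact (closure {x. \<phi> x \<noteq> 0}) \<and> closure {x. \<phi> x \<noteq> 0} \<subseteq> \<Omega>}"

text \<open>
  Elements of Lebesgue spaces are represented by functions, without passing to classes
  modulo a.e. equality; only the values on \<open>\<Omega>\<close> are relevant.
\<close>

definition L2 :: "'a::euclidean_space set \<Rightarrow> ('a \<Rightarrow> real) set" where
  "L2 \<Omega> = {f \<in> borel_measurable (lebesgue_on \<Omega>). integrable (lebesgue_on \<Omega>) (\<lambda>x. (f x)\<^sup>2)}"

definition L2_inner :: "'a::euclidean_space set \<Rightarrow> ('a \<Rightarrow> real) \<Rightarrow> ('a \<Rightarrow> real) \<Rightarrow> real" where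
  "L2_inner \<Omega> f g = (\<integral>x. f x * g x \<partial>lebesgue_on \<Omega>)"

definition Linf :: "'a::euclidean_space set \<Rightarrow> ('a \<Rightarrow> real) set" where
  "Linf Q = {f \<in> borel_measurable (lebesgue_on Q). \<exists>C. AE z in lebesgue_on Q. \<bar>f z\<bar> \<le> C}"

text \<open>
  \<open>L\<^sup>\<infinity>([0,T];L\<^sup>\<infinity>(\<Omega>))\<close>, read in the usual way as \<open>L\<^sup>\<infinity>([0,T] \<times> \<Omega>)\<close>, the dual of
  \<open>L\<^sup>1([0,T];L\<^sup>1(\<Omega>))\<close>. Strong Bochner measurability into the nonseparable space
  \<open>L\<^sup>\<infinity>(\<Omega>)\<close> is not meant: it is not preserved by limits of weakly equi-continuous
  sequences. Since Lebesgue measure is complete, every map from \<open>[0,T]\<close> into the classes of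
  \<open>L\<^sup>2(\<Omega>)\<close> that agrees for a.e. \<open>t\<close> with an element of this space has a representative
  here that agrees with it, as a class, for every \<open>t\<close>.
\<close>

definition Linf_Linf :: "real \<Rightarrow> 'a::euclidean_space set \<Rightarrow> (real \<Rightarrow> 'a \<Rightarrow> real) set" where
  "Linf_Linf T \<Omega> = {u. (\<lambda>(t, x). u t x) \<in> Linf ({0..T} \<times> \<Omega>)}"

definition equicontinuous_family_on ::
  "'a::metric_space set \<Rightarrow> ('i \<Rightarrow> 'a \<Rightarrow> 'b::metric_space) \<Rightarrow> bool" where
  "equicontinuous_family_on S F \<longleftrightarrow>
     (\<forall>t\<in>S. \<forall>\<epsilon>>0. \<exists>\<delta>>0. \<forall>k. \<forall>s\<in>S. dist s t < \<delta> \<longrightarrow> dist (F k s) (F k t) < \<epsilon>)"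

text \<open>
  Weak convergence in the Hilbert space \<open>L\<^sup>2(\<Omega>)\<close>, the continuous functionals being the
  inner products with elements of \<open>L\<^sup>2(\<Omega>)\<close>.
\<close>

definition weakly_converges_L2 ::
  "'a::euclidean_space set \<Rightarrow> (nat \<Rightarrow> 'a \<Rightarrow> real) \<Rightarrow> ('a \<Rightarrow> real) \<Rightarrow> bool" where
  "weakly_converges_L2 \<Omega> f g \<longleftrightarrow>
     (\<forall>k. f k \<in> L2 \<Omega>) \<and> g \<in> L2 \<Omega> \<and>
     (\<forall>\<psi>\<in>L2 \<Omega>. (\<lambda>k. L2_inner \<Omega> (f k) \<psi>) \<longlonglongrightarrow> L2_inner \<Omega> g \<psi>)"

end

theory Submission
  imports Defs "HOL-Computational_Algebra.Polynomial" "HOL-Complex_Analysis.Great_Picard"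
begin

text \<open>
  Everything rests on one countable family of test functions. Products of the functions
  \<open>exp (- 1 / x)\<close> are smooth bumps supported in a prescribed box, and they increase to the
  indicator of the box when the profile is steepened; with rational corners and integer steepness
  only countably many are needed. A Dynkin-class argument then shows that this family is
  determining: for functions with values in \<open>[\<alpha>, \<beta>]\<close>, convergence of the pairings with all bumps
  already gives convergence of the integrals over all measurable subsets of \<open>\<Omega>\<close>. The limits form a
  measure with \<open>\<alpha> |A| \<le> \<nu> A \<le> \<beta> |A|\<close>, and its Radon-Nikodym density is a weak limit with values
  in \<open>[\<alpha>, \<beta>]\<close>. Density of simple functions
  extends the convergence to all integrable, hence all square integrable, test functions
  (\<open>weak_limit_if_bump_integrals_converge\<close>).

  The bounds \<open>\<alpha> \<le> \<rho>\<^sub>k \<le> \<beta>\<close> are given almost everywhere in \<open>(t, x)\<close>, but are needed at every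
  \<open>t\<close>. By Fubini they hold at almost every, hence at a dense set of times; since
  \<open>t \<mapsto> (\<rho>\<^sub>k(t), \<phi>)\<close> is continuous, \<open>\<rho>\<^sub>k(t)\<close> is the weak limit of slices at good times, and
  weak limits inherit the bounds (\<open>bounds_at_every_time\<close>). Now the pairings are bounded, a diagonal
  sequence makes them converge for all bumps and all \<open>t\<close> in a countable dense set of times, and
  equicontinuity carries the convergence to every \<open>t\<close>. This yields a weak limit \<open>R t\<close> for each \<open>t\<close>.

  The slices \<open>R t\<close> are chosen independently of each other, so \<open>(t, x) \<mapsto> R t x\<close> need not be
  measurable. A jointly measurable version comes from applying the Radon-Nikodym argument once more,
  now on \<open>[0,T] \<times> \<Omega>\<close>: integrals against bounded functions converge there by Fubini and dominated
  convergence in \<open>t\<close>. The resulting density \<open>g\<close> satisfies \<open>g(t, \<cdot>) = R t\<close> a.e. for almost every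
  \<open>t\<close>, because both have the same pairings with the countably many bumps
  (\<open>jointly_measurable_weak_limit\<close>). The function \<open>\<rho>'\<close> is \<open>g\<close> at those times and \<open>R\<close> at the
  remaining ones: changing \<open>g\<close> on a null set of times keeps it Lebesgue measurable, and every slice
  is now a weak limit.
\<close>

section \<open>Smooth bumps on boxes\<close>

lemma Ck_add:
  fixes f g :: "'a::euclidean_space \<Rightarrow> real"
  shows "Ck k f \<Longrightarrow> Ck k g \<Longrightarrow> Ck k (\<lambda>x. f x + g x)"
proof (induction k arbitrary: f g)
  case 0
  then show ?case by (simp add: continuous_on_add)
next
  case (Suc k)
  have "((\<lambda>x. f x + g x) has_derivative
          (\<lambda>v. frechet_derivative f (at x) v + frechet_derivative g (at x) v)) (at x)" for x
    using Suc.prems by (auto intro!: has_derivative_add simp: frechet_derivative_works)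
  then have "(\<lambda>x. f x + g x) differentiable (at x)"
    and "frechet_derivative (\<lambda>x. f x + g x) (at x) =
          (\<lambda>v. frechet_derivative f (at x) v + frechet_derivative g (at x) v)" for x
    by (auto simp: differentiable_def intro!: frechet_derivative_at[symmetric])
  with Suc show ?case by simp
qed

lemma Ck_continuous: "Ck k f \<Longrightarrow> continuous_on UNIV f"
  by (cases k) (auto intro!: continuous_at_imp_continuous_on differentiable_imp_continuous_within)

text \<open>
  The recursion differentiates first and tests continuity last, so \<open>C\<^sup>k\<^sup>+\<^sup>1\<close> functions are not
  \<open>C\<^sup>k\<close> by definition; the product rule needs this, as it multiplies a derivative by an
  undifferentiated factor.
\<close>

lemma Ck_Suc_imp_Ck: "Ck (Suc k) f \<Longrightarrow> Ck k f"
proof (induction k arbitrary: f)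
  case 0
  then show ?case by (metis Ck.simps(1) Ck_continuous)
next
  case (Suc k)
  then show ?case by (metis Ck.simps(2))
qed

lemma Ck_mult:
  fixes f g :: "'a::euclidean_space \<Rightarrow> real"
  shows "Ck k f \<Longrightarrow> Ck k g \<Longrightarrow> Ck k (\<lambda>x. f x * g x)"
proof (induction k arbitrary: f g)
  case 0
  then show ?case by (simp add: continuous_on_mult)
next
  case (Suc k)
  have "((\<lambda>x. f x * g x) has_derivative
          (\<lambda>v. f x * frechet_derivative g (at x) v + frechet_derivative f (at x) v * g x)) (at x)" for x
    using Suc.prems by (auto intro!: has_derivative_mult simp: frechet_derivative_works)
  then have "(\<lambda>x. f x * g x) differentiable (at x)"
    and "frechet_derivative (\<lambda>x. f x * g x) (at x) =
          (\<lambda>v. f x * frechet_derivative g (at x) v + frechet_derivative f (at x) v * g x)" for x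
    by (auto simp: differentiable_def intro!: frechet_derivative_at[symmetric])
  moreover have "Ck k f" "Ck k g"
    using Suc.prems Ck_Suc_imp_Ck by blast+
  ultimately show ?case
    using Suc by (auto intro!: Ck_add)
qed

lemma Ck_const:
  fixes c :: real
  shows "Ck k (\<lambda>x::'a::euclidean_space. c)"
  by (induction k arbitrary: c) (simp_all add: frechet_derivative_const)

lemma Ck_prod:
  fixes f :: "'i \<Rightarrow> 'a::euclidean_space \<Rightarrow> real"
  shows "(\<And>i. i \<in> I \<Longrightarrow> Ck k (f i)) \<Longrightarrow> Ck k (\<lambda>x. \<Prod>i\<in>I. f i x)"
  by (induction I rule: infinite_finite_induct) (simp_all add: Ck_const Ck_mult)

text \<open>
  The functions \<open>p(1/x) exp(-1/x)\<close>, extended by zero, for all polynomials \<open>p\<close> at once: this class,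
  unlike the single function \<open>exp(-1/x)\<close>, is closed under differentiation.
\<close>

definition flat :: "real poly \<Rightarrow> real \<Rightarrow> real" where
  "flat p x = (if 0 < x then poly p (inverse x) * exp (- inverse x) else 0)"

definition flat_deriv :: "real poly \<Rightarrow> real poly" where
  "flat_deriv p = [:0, 0, 1:] * (p - pderiv p)"

lemma tendsto_poly_times_exp_minus:
  fixes p :: "real poly"
  shows "((\<lambda>y. poly p y * exp (- y)) \<longlongrightarrow> 0) at_top"
proof -
  have "((\<lambda>y. \<Sum>i\<le>degree p. coeff p i * (y ^ i / exp y)) \<longlongrightarrow> (\<Sum>i\<le>degree p. coeff p i * 0)) at_top"
    by (intro tendsto_sum tendsto_mult tendsto_const tendsto_power_div_exp_0)
  then show ?thesis
    by (simp add: poly_altdef exp_minus sum_distrib_right divide_inverse mult.assoc)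
qed

text \<open>
  At the origin the difference quotient from the right is \<open>y p(y) exp(-y)\<close> with
  \<open>y = 1/h \<rightarrow> \<infinity>\<close>, again a polynomial times a decaying exponential.
\<close>

lemma flat_has_derivative: "(flat p has_real_derivative flat (flat_deriv p) x) (at x)"
proof -
  consider "x > 0" | "x < 0" | "x = 0" by linarith
  then show ?thesis
  proof cases
    case 1
    have "((\<lambda>x. poly p (inverse x)) has_real_derivative poly (pderiv p) (inverse x) * - (inverse x)\<^sup>2) (at x)"
      using 1 DERIV_inverse[of x UNIV]
      by (intro DERIV_chain2[OF poly_DERIV]) (simp_all add: power2_eq_square)
    moreover have "((\<lambda>x. exp (- inverse x)) has_real_derivative exp (- inverse x) * (inverse x)\<^sup>2) (at x)"
      using 1 by (auto intro!: derivative_eq_intros simp: power2_eq_square)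
    ultimately have "((\<lambda>x. poly p (inverse x) * exp (- inverse x)) has_real_derivative
            poly (pderiv p) (inverse x) * - (inverse x)\<^sup>2 * exp (- inverse x) +
            exp (- inverse x) * (inverse x)\<^sup>2 * poly p (inverse x)) (at x)"
      by (rule DERIV_mult)
    moreover have "poly (pderiv p) (inverse x) * - (inverse x)\<^sup>2 * exp (- inverse x) +
            exp (- inverse x) * (inverse x)\<^sup>2 * poly p (inverse x) = flat (flat_deriv p) x"
      using 1 by (simp add: flat_def flat_deriv_def power2_eq_square algebra_simps)
    ultimately have "((\<lambda>x. poly p (inverse x) * exp (- inverse x)) has_real_derivative
            flat (flat_deriv p) x) (at x)"
      by simp
    moreover have ev: "eventually (\<lambda>y. flat p y = poly p (inverse y) * exp (- inverse y)) (nhds x)"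
      using eventually_nhds_in_open[of "{0<..}" x] 1 by (auto elim!: eventually_mono simp: flat_def)
    ultimately show ?thesis
      by (simp only: DERIV_cong_ev[OF refl ev refl])
  next
    case 2
    have ev: "eventually (\<lambda>y. flat p y = 0) (nhds x)"
      using eventually_nhds_in_open[of "{..<0}" x] 2 by (auto elim!: eventually_mono simp: flat_def)
    moreover have "((\<lambda>x. 0) has_real_derivative flat (flat_deriv p) x) (at x)"
      using 2 by (simp add: flat_def)
    ultimately show ?thesis
      by (simp only: DERIV_cong_ev[OF refl ev refl])
  next
    case 3
    have "((\<lambda>h. poly (pCons 0 p) (inverse h) * exp (- inverse h)) \<longlongrightarrow> 0) (at_right 0)"
      by (rule filterlim_compose[OF tendsto_poly_times_exp_minus filterlim_inverse_at_top_right])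
    then have "((\<lambda>h. flat p h / h) \<longlongrightarrow> 0) (at_right 0)"
      by (rule Lim_transform_eventually)
         (auto simp: eventually_at_right_field flat_def field_simps intro!: exI[of _ 1])
    moreover have "((\<lambda>h. flat p h / h) \<longlongrightarrow> 0) (at_left 0)"
      by (rule Lim_transform_eventually[OF tendsto_const])
         (auto simp: eventually_at_left_field flat_def intro!: exI[of _ "-1"])
    ultimately have "((\<lambda>h. flat p h / h) \<longlongrightarrow> 0) (at 0)"
      by (simp add: filterlim_split_at)
    then show ?thesis
      using 3 by (simp add: DERIV_def flat_def)
  qed
qed

text \<open>
  The constant \<open>c\<close> makes the induction work: differentiating in direction \<open>v\<close> only replaces \<open>c\<close>
  by \<open>c (u \<bullet> v)\<close> and \<open>p\<close> by \<open>flat_deriv p\<close>.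
\<close>

lemma Ck_flat_affine: "Ck k (\<lambda>x::'a::euclidean_space. c * flat p (u \<bullet> x + d))"
proof (induction k arbitrary: c p)
  case 0
  have "continuous_on UNIV (flat p)"
    by (auto intro!: continuous_at_imp_continuous_on DERIV_isCont[OF flat_has_derivative])
  then have "continuous_on UNIV (\<lambda>x. flat p (u \<bullet> x + d))"
    by (rule continuous_on_compose2) (auto intro!: continuous_intros)
  then show ?case
    by (auto intro!: continuous_intros)
next
  case (Suc k)
  have "((\<lambda>x::'a. c * flat p (u \<bullet> x + d)) has_derivative
         (\<lambda>v. c * (u \<bullet> v) * flat (flat_deriv p) (u \<bullet> x + d))) (at x)" for x
  proof -
    have "((\<lambda>x::'a. u \<bullet> x + d) has_derivative (\<lambda>v. u \<bullet> v)) (at x)"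
      by (auto intro!: derivative_eq_intros)
    then have "((\<lambda>x::'a. flat p (u \<bullet> x + d)) has_derivative
               (\<lambda>v. (u \<bullet> v) * flat (flat_deriv p) (u \<bullet> x + d))) (at x)"
      by (rule DERIV_compose_FDERIV[OF flat_has_derivative])
    from has_derivative_mult_right[OF this, of c] show ?thesis
      by (simp add: mult.assoc)
  qed
  then have "(\<lambda>x::'a. c * flat p (u \<bullet> x + d)) differentiable (at x)"
    and "frechet_derivative (\<lambda>x::'a. c * flat p (u \<bullet> x + d)) (at x) =
         (\<lambda>v. c * (u \<bullet> v) * flat (flat_deriv p) (u \<bullet> x + d))" for x
    by (auto simp: differentiable_def intro!: frechet_derivative_at[symmetric])
  with Suc show ?case by simp
qed

text \<open>
  The factor \<open>Suc n\<close> sits inside the profile, and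
  \<open>exp (- 1 / (m x)) = exp (- 1 / x) powr (1 / m)\<close>; so \<open>bump a b n\<close> is a root of the bump
  \<open>bump a b 0\<close>, and such roots tend to one wherever the bump is positive.
\<close>

definition bump :: "'a::euclidean_space \<Rightarrow> 'a \<Rightarrow> nat \<Rightarrow> 'a \<Rightarrow> real" where
  "bump a b n x =
    (\<Prod>i\<in>Basis. flat 1 (real (Suc n) * (x \<bullet> i - a \<bullet> i)) * flat 1 (real (Suc n) * (b \<bullet> i - x \<bullet> i)))"

lemma Ck_bump: "Ck k (bump a b n)"
proof -
  have "Ck k (\<lambda>x::'a. flat 1 (real (Suc n) * (x \<bullet> i - a \<bullet> i)) * flat 1 (real (Suc n) * (b \<bullet> i - x \<bullet> i)))"
    for i
    using Ck_mult[OF Ck_flat_affine[of k 1 1 "real (Suc n) *\<^sub>R i" "- real (Suc n) * (a \<bullet> i)"]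
       Ck_flat_affine[of k 1 1 "- real (Suc n) *\<^sub>R i" "real (Suc n) * (b \<bullet> i)"]]
    by (simp add: algebra_simps inner_commute)
  then have "Ck k (\<lambda>x::'a. \<Prod>i\<in>Basis. flat 1 (real (Suc n) * (x \<bullet> i - a \<bullet> i)) * flat 1 (real (Suc n) * (b \<bullet> i - x \<bullet> i)))"
    by (intro Ck_prod)
  then show ?thesis
    by (simp add: bump_def[abs_def])
qed

lemma flat_1_bounds: "0 \<le> flat 1 x" "flat 1 x \<le> 1"
  by (auto simp: flat_def)

lemma bump_bounds: "0 \<le> bump a b n x" "bump a b n x \<le> 1"
  unfolding bump_def
  by (auto intro!: prod_nonneg prod_le_1 mult_nonneg_nonneg mult_le_one simp: flat_1_bounds)

lemma bump_nonzero_iff: "bump a b n x \<noteq> 0 \<longleftrightarrow> x \<in> box a b"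
  by (auto simp: bump_def flat_def box_def zero_less_mult_iff)

lemma bump_tendsto_indicator: "(\<lambda>n. bump a b n x) \<longlonglongrightarrow> indicator (box a b) x"
proof (cases "x \<in> box a b")
  case False
  then have "bump a b n x = 0" for n using bump_nonzero_iff by blast
  with False show ?thesis by simp
next
  case True
  have lim1: "(\<lambda>n. flat 1 (real (Suc n) * y)) \<longlonglongrightarrow> 1" if "y > 0" for y
  proof -
    have "(\<lambda>n. exp (- (inverse (real (Suc n)) * inverse y))) \<longlonglongrightarrow> exp (- (0 * inverse y))"
      by (intro tendsto_intros LIMSEQ_inverse_real_of_nat)
    moreover have "flat 1 (real (Suc n) * y) = exp (- (inverse (real (Suc n)) * inverse y))" for n
      using that by (simp add: flat_def zero_less_mult_iff)
    ultimately show ?thesis by simp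
  qed
  have "(\<lambda>n. bump a b n x) \<longlonglongrightarrow> (\<Prod>i\<in>(Basis::'a set). 1 * 1)"
    unfolding bump_def using True by (intro tendsto_prod tendsto_mult lim1) (auto simp: box_def)
  with True show ?thesis by simp
qed

lemma bump_in_test_functions:
  assumes "cbox a b \<subseteq> \<Omega>"
  shows "bump a b n \<in> test_functions \<Omega>"
proof -
  have "closure {x. bump a b n x \<noteq> 0} \<subseteq> cbox a b"
    by (rule closure_minimal) (auto simp: bump_nonzero_iff box_subset_cbox[THEN subsetD])
  moreover from this have "compact (closure {x. bump a b n x \<noteq> 0})"
    by (metis closed_closure compact_Int_closed compact_cbox inf.absorb_iff2)
  ultimately show ?thesis
    using assms by (auto simp: test_functions_def Ck_bump)
qed

text \<open>
  Pairs with \<open>a \<bullet> i > b \<bullet> i\<close> in some coordinate, hence empty boxes, are admitted; this makes the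
  boxes closed under intersection.
\<close>

definition rational_corner_pairs :: "'a::euclidean_space set \<Rightarrow> ('a \<times> 'a) set" where
  "rational_corner_pairs \<Omega> =
     {(a, b). (\<forall>i\<in>Basis. a \<bullet> i \<in> \<rat> \<and> b \<bullet> i \<in> \<rat>) \<and> cbox a b \<subseteq> \<Omega>}"

definition bumps :: "'a::euclidean_space set \<Rightarrow> ('a \<Rightarrow> real) set" where
  "bumps \<Omega> = {bump a b n | a b n. (a, b) \<in> rational_corner_pairs \<Omega>}"

lemma countable_rational_points: "countable {a::'a::euclidean_space. \<forall>i\<in>Basis. a \<bullet> i \<in> \<rat>}"
proof -
  have "countable (Basis \<rightarrow>\<^sub>E \<rat> :: ('a \<Rightarrow> real) set)"
    by (intro countable_PiE countable_rat) auto
  moreover have "{a::'a. \<forall>i\<in>Basis. a \<bullet> i \<in> \<rat>} \<subseteq> (\<lambda>f. \<Sum>i\<in>Basis. f i *\<^sub>R i) ` (Basis \<rightarrow>\<^sub>E \<rat>)"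
  proof
    fix a :: 'a assume "a \<in> {a. \<forall>i\<in>Basis. a \<bullet> i \<in> \<rat>}"
    then show "a \<in> (\<lambda>f. \<Sum>i\<in>Basis. f i *\<^sub>R i) ` (Basis \<rightarrow>\<^sub>E \<rat>)"
      by (intro image_eqI[of _ _ "restrict (\<lambda>i. a \<bullet> i) Basis"]) (auto simp: euclidean_representation)
  qed
  ultimately show ?thesis
    by (meson countable_image countable_subset)
qed

lemma countable_rational_corner_pairs: "countable (rational_corner_pairs \<Omega>)"
  by (rule countable_subset[OF _ countable_SIGMA[OF countable_rational_points countable_rational_points]])
     (auto simp: rational_corner_pairs_def)

lemma countable_bumps: "countable (bumps \<Omega>)"
proof -
  have "bumps \<Omega> = (\<lambda>((a, b), n). bump a b n) ` (rational_corner_pairs \<Omega> \<times> UNIV)"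
    by (force simp: bumps_def)
  then show ?thesis
    by (simp add: countable_rational_corner_pairs)
qed

lemma bumps_subset_test_functions: "bumps \<Omega> \<subseteq> test_functions \<Omega>"
  by (auto simp: bumps_def rational_corner_pairs_def intro!: bump_in_test_functions)

lemma borel_measurable_bumps:
  assumes "\<phi> \<in> bumps \<Omega>" shows "\<phi> \<in> borel_measurable borel"
  using assms Ck_bump[of 0] by (auto simp: bumps_def intro!: borel_measurable_continuous_onI)

lemma abs_bumps_le_1: "\<phi> \<in> bumps \<Omega> \<Longrightarrow> \<bar>\<phi> x\<bar> \<le> 1"
  by (auto simp: bumps_def bump_bounds)

section \<open>Weak limits of bounded functions on a finite measure space\<close>

text \<open>
  Convergence passes to uniform limits of sequences, here with \<open>e i\<close> bounding the uniform
  distance of \<open>X i\<close> to \<open>Z\<close>. It lets convergence of pairings pass from a class of test functions to its closure.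
\<close>

lemma convergent_uniform_approx:
  fixes X :: "nat \<Rightarrow> nat \<Rightarrow> real"
  assumes X: "\<And>i. convergent (X i)" and approx: "\<And>i k. \<bar>X i k - Z k\<bar> \<le> e i" and e: "e \<longlonglongrightarrow> 0"
  shows "convergent Z"
proof (rule Cauchy_convergent, rule metric_CauchyI)
  fix r :: real assume "r > 0"
  then have "eventually (\<lambda>i. e i < r / 3) sequentially"
    using order_tendstoD(2)[OF e, of "r / 3"] by simp
  then obtain i where i: "e i < r / 3"
    by (auto simp: eventually_sequentially)
  obtain N where N: "\<And>m n. m \<ge> N \<Longrightarrow> n \<ge> N \<Longrightarrow> dist (X i m) (X i n) < r / 3"
    using convergent_Cauchy[OF X[of i]] \<open>r > 0\<close> by (meson metric_CauchyD divide_pos_pos zero_less_numeral)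
  have "dist (Z m) (Z n) < r" if "m \<ge> N" "n \<ge> N" for m n
    using N[OF that] approx[of i m] approx[of i n] i unfolding dist_real_def by argo
  then show "\<exists>M. \<forall>m\<ge>M. \<forall>n\<ge>M. dist (Z m) (Z n) < r" by blast
qed

lemma tendsto_uniform_approx:
  fixes X :: "nat \<Rightarrow> nat \<Rightarrow> real"
  assumes X: "\<And>i. X i \<longlonglongrightarrow> Y i" and approx: "\<And>i k. \<bar>X i k - Z k\<bar> \<le> e i"
    and lim: "\<And>i. \<bar>Y i - W\<bar> \<le> e i" and e: "e \<longlonglongrightarrow> 0"
  shows "Z \<longlonglongrightarrow> W"
proof (rule LIMSEQ_I)
  fix r :: real assume "r > 0"
  then have "eventually (\<lambda>i. e i < r / 3) sequentially"
    using order_tendstoD(2)[OF e, of "r / 3"] by simp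
  then obtain i where i: "e i < r / 3"
    by (auto simp: eventually_sequentially)
  obtain N where N: "\<And>n. n \<ge> N \<Longrightarrow> norm (X i n - Y i) < r / 3"
    using LIMSEQ_D[OF X[of i], of "r / 3"] \<open>r > 0\<close> by auto
  have "norm (Z n - W) < r" if "n \<ge> N" for n
    using N[OF that] approx[of i n] lim[of i] i unfolding real_norm_def by argo
  then show "\<exists>no. \<forall>n\<ge>no. norm (Z n - W) < r" by blast
qed

text \<open>
  Take \<open>A = {x. h x < 0}\<close>: the integral over \<open>A\<close> is both nonnegative and an integral of a
  nonpositive function.
\<close>

lemma AE_nonneg_if_integrals_nonneg:
  fixes h :: "'a \<Rightarrow> real"
  assumes h: "integrable M h" and nonneg: "\<And>A. A \<in> sets M \<Longrightarrow> 0 \<le> (\<integral>x. h x * indicator A x \<partial>M)"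
  shows "AE x in M. 0 \<le> h x"
proof -
  have [measurable]: "h \<in> borel_measurable M" using h by auto
  define A where "A = {x \<in> space M. h x < 0}"
  have [measurable]: "A \<in> sets M" by (simp add: A_def)
  have int: "integrable M (\<lambda>x. - (h x * indicator A x))"
    using integrable_real_mult_indicator[OF \<open>A \<in> sets M\<close> h] by simp
  have pos: "AE x in M. 0 \<le> - (h x * indicator A x)"
    by (rule AE_I2) (simp add: A_def indicator_def)
  have "(\<integral>x. - (h x * indicator A x) \<partial>M) = 0"
    using nonneg[OF \<open>A \<in> sets M\<close>] integral_nonneg_AE[OF pos] by simp
  then have "AE x in M. - (h x * indicator A x) = 0"
    using integral_nonneg_eq_0_iff_AE[OF int pos] by blast
  moreover have "AE x in M. x \<in> space M" by simp
  ultimately show ?thesis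
    by eventually_elim (auto simp: A_def indicator_def)
qed

lemma AE_eq_if_integrals_eq:
  fixes f g :: "'a \<Rightarrow> real"
  assumes f: "integrable M f" and g: "integrable M g"
    and eq: "\<And>A. A \<in> sets M \<Longrightarrow> (\<integral>x. f x * indicator A x \<partial>M) = (\<integral>x. g x * indicator A x \<partial>M)"
  shows "AE x in M. f x = g x"
proof -
  have ind: "integrable M (\<lambda>x. h x * indicator A x)" if "A \<in> sets M" "integrable M h" for A and h :: "'a \<Rightarrow> real"
    using integrable_real_mult_indicator[OF that] .
  have "AE x in M. 0 \<le> f x - g x"
    by (rule AE_nonneg_if_integrals_nonneg)
       (use f g in \<open>simp_all add: left_diff_distrib ind eq\<close>)
  moreover have "AE x in M. 0 \<le> g x - f x"
    by (rule AE_nonneg_if_integrals_nonneg)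
       (use f g in \<open>simp_all add: left_diff_distrib ind eq\<close>)
  ultimately show ?thesis by eventually_elim simp
qed

lemma integrable_bounded_mult:
  fixes f \<psi> :: "'a \<Rightarrow> real"
  assumes "integrable M \<psi>" "f \<in> borel_measurable M" "AE x in M. \<bar>f x\<bar> \<le> C"
  shows "integrable M (\<lambda>x. f x * \<psi> x)"
proof (rule Bochner_Integration.integrable_bound[of M "\<lambda>x. C * \<psi> x"])
  show "AE x in M. norm (f x * \<psi> x) \<le> norm (C * \<psi> x)"
    using assms(3) by eventually_elim (auto simp: abs_mult intro!: mult_right_mono)
qed (use assms in auto)

lemma integral_bounded_mult_le:
  fixes f \<psi> :: "'a \<Rightarrow> real"
  assumes "integrable M \<psi>" "f \<in> borel_measurable M" "AE x in M. \<bar>f x\<bar> \<le> C"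
  shows "\<bar>\<integral>x. f x * \<psi> x \<partial>M\<bar> \<le> C * (\<integral>x. \<bar>\<psi> x\<bar> \<partial>M)"
proof -
  have "\<bar>\<integral>x. f x * \<psi> x \<partial>M\<bar> \<le> (\<integral>x. \<bar>f x * \<psi> x\<bar> \<partial>M)"
    by (rule integral_abs_bound)
  also have "\<dots> \<le> (\<integral>x. C * \<bar>\<psi> x\<bar> \<partial>M)"
  proof (rule integral_mono_AE)
    show "AE x in M. \<bar>f x * \<psi> x\<bar> \<le> C * \<bar>\<psi> x\<bar>"
      using assms(3) by eventually_elim (auto simp: abs_mult intro!: mult_right_mono)
  qed (use assms in \<open>auto intro!: integrable_abs integrable_bounded_mult\<close>)
  finally show ?thesis by simp
qed

text \<open>
  The pairing is \<open>C\<close>-Lipschitz in \<open>\<psi>\<close> for the \<open>L\<^sup>1\<close> norm, uniformly in \<open>k\<close>, and simple functions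
  are dense in \<open>L\<^sup>1\<close>.
\<close>

lemma tendsto_integral_bounded_weak:
  fixes f :: "nat \<Rightarrow> 'a \<Rightarrow> real"
  assumes "finite_measure M"
    and f: "\<And>k. f k \<in> borel_measurable M" "\<And>k. AE x in M. \<bar>f k x\<bar> \<le> C"
    and g: "g \<in> borel_measurable M" "AE x in M. \<bar>g x\<bar> \<le> C"
    and sets: "\<And>A. A \<in> sets M \<Longrightarrow>
      (\<lambda>k. \<integral>x. f k x * indicator A x \<partial>M) \<longlonglongrightarrow> (\<integral>x. g x * indicator A x \<partial>M)"
    and \<psi>: "integrable M \<psi>"
  shows "(\<lambda>k. \<integral>x. f k x * \<psi> x \<partial>M) \<longlonglongrightarrow> (\<integral>x. g x * \<psi> x \<partial>M)"
  using \<psi>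
proof (induction rule: integrable_induct)
  case (base A c)
  have "(\<lambda>k. c * (\<integral>x. f k x * indicator A x \<partial>M)) \<longlonglongrightarrow> c * (\<integral>x. g x * indicator A x \<partial>M)"
    by (intro tendsto_mult tendsto_const sets base)
  moreover have "c * (\<integral>x. h x * indicator A x \<partial>M) = (\<integral>x. h x * (indicator A x *\<^sub>R c) \<partial>M)" for h :: "'a \<Rightarrow> real"
    by (simp flip: integral_mult_right_zero add: mult_ac)
  ultimately show ?case by simp
next
  case (add \<psi>1 \<psi>2)
  have "(\<integral>x. h x * (\<psi>1 x + \<psi>2 x) \<partial>M) = (\<integral>x. h x * \<psi>1 x \<partial>M) + (\<integral>x. h x * \<psi>2 x \<partial>M)"
    if "h \<in> borel_measurable M" "AE x in M. \<bar>h x\<bar> \<le> C" for h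
    using integrable_bounded_mult[OF add.hyps(1) that] integrable_bounded_mult[OF add.hyps(2) that]
    by (simp add: distrib_left)
  then show ?case
    using tendsto_add[OF add.IH] by (simp only: f g)
next
  case (lim \<psi> s)
  define e where "e i = C * (\<integral>x. \<bar>s i x - \<psi> x\<bar> \<partial>M)" for i
  have "(\<lambda>i. \<integral>x. \<bar>s i x - \<psi> x\<bar> \<partial>M) \<longlonglongrightarrow> (\<integral>x. 0 \<partial>M)"
  proof (rule integral_dominated_convergence)
    \<comment> \<open>the approximants satisfy \<open>\<bar>s i x\<bar> \<le> 2 * \<bar>\<psi> x\<bar>\<close>\<close>
    show "integrable M (\<lambda>x. 3 * \<bar>\<psi> x\<bar>)"
      using lim.hyps(4) by auto
    show "AE x in M. (\<lambda>i. \<bar>s i x - \<psi> x\<bar>) \<longlonglongrightarrow> 0"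
    proof (rule AE_I2)
      fix x assume "x \<in> space M"
      then have "(\<lambda>i. s i x - \<psi> x) \<longlonglongrightarrow> 0"
        by (intro LIM_zero lim.hyps(2))
      then show "(\<lambda>i. \<bar>s i x - \<psi> x\<bar>) \<longlonglongrightarrow> 0"
        by (rule tendsto_rabs_zero)
    qed
    show "AE x in M. norm \<bar>s i x - \<psi> x\<bar> \<le> 3 * \<bar>\<psi> x\<bar>" for i
    proof (rule AE_I2)
      fix x assume "x \<in> space M"
      then show "norm \<bar>s i x - \<psi> x\<bar> \<le> 3 * \<bar>\<psi> x\<bar>"
        using lim.hyps(3)[of x i] abs_triangle_ineq4[of "s i x" "\<psi> x"] by simp
    qed
  qed (use lim.hyps in auto)
  then have "e \<longlonglongrightarrow> 0"
    unfolding e_def by (auto intro: tendsto_mult_right_zero)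
  have approx: "\<bar>(\<integral>x. h x * s i x \<partial>M) - (\<integral>x. h x * \<psi> x \<partial>M)\<bar> \<le> e i"
    if "h \<in> borel_measurable M" "AE x in M. \<bar>h x\<bar> \<le> C" for h i
  proof -
    have "(\<integral>x. h x * s i x \<partial>M) - (\<integral>x. h x * \<psi> x \<partial>M) = (\<integral>x. h x * (s i x - \<psi> x) \<partial>M)"
      using integrable_bounded_mult[OF lim.hyps(1) that] integrable_bounded_mult[OF lim.hyps(4) that]
      by (simp add: right_diff_distrib)
    then show ?thesis
      using integral_bounded_mult_le[OF Bochner_Integration.integrable_diff[OF lim.hyps(1) lim.hyps(4)] that]
      by (simp add: e_def)
  qed
  show ?case
    by (rule tendsto_uniform_approx[OF lim.IH approx[OF f] approx[OF g] \<open>e \<longlonglongrightarrow> 0\<close>])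
qed

text \<open>
  The limits \<open>\<nu> A\<close> of the integrals over \<open>A\<close> are finitely additive and lie between \<open>a |A|\<close> and
  \<open>b |A|\<close>. The upper bound gives continuity at the empty set, hence countable additivity, and
  absolute continuity; the weak limit is the Radon-Nikodym density. Clamping it to \<open>[a, b]\<close> changes
  it on a null set only and makes the bounds hold everywhere, which spares exceptional sets later.
\<close>

lemma bounded_weak_limit_exists:
  fixes f :: "nat \<Rightarrow> 'a \<Rightarrow> real"
  assumes "finite_measure M" and ab: "0 \<le> a" "a \<le> b"
    and f: "\<And>k. f k \<in> borel_measurable M" "\<And>k. AE x in M. a \<le> f k x \<and> f k x \<le> b"
    and conv: "\<And>A. A \<in> sets M \<Longrightarrow> convergent (\<lambda>k. \<integral>x. f k x * indicator A x \<partial>M)"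
  obtains g where "g \<in> borel_measurable M" "\<And>x. a \<le> g x" "\<And>x. g x \<le> b"
    "\<And>\<psi>. integrable M \<psi> \<Longrightarrow> (\<lambda>k. \<integral>x. f k x * \<psi> x \<partial>M) \<longlonglongrightarrow> (\<integral>x. g x * \<psi> x \<partial>M)"
proof -
  interpret finite_measure M by fact
  have f_abs: "AE x in M. \<bar>f k x\<bar> \<le> b" for k
    using f(2)[of k] by eventually_elim (use ab in auto)
  have int1: "integrable M (indicator A :: _ \<Rightarrow> real)" if "A \<in> sets M" for A
    using that by (auto simp: less_top[symmetric])
  have int: "integrable M (\<lambda>x. f k x * indicator A x)" if "A \<in> sets M" for k A
    by (rule integrable_bounded_mult[OF int1 f(1) f_abs]) fact
  define \<nu> where "\<nu> A = lim (\<lambda>k. \<integral>x. f k x * indicator A x \<partial>M)" for A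
  have \<nu>: "(\<lambda>k. \<integral>x. f k x * indicator A x \<partial>M) \<longlonglongrightarrow> \<nu> A" if "A \<in> sets M" for A
    using conv[OF that] by (simp add: \<nu>_def convergent_LIMSEQ_iff)
  have bounds_k: "a * measure M A \<le> (\<integral>x. f k x * indicator A x \<partial>M)"
     "(\<integral>x. f k x * indicator A x \<partial>M) \<le> b * measure M A" if A: "A \<in> sets M" for A k
  proof -
    have "(\<integral>x. a * indicator A x \<partial>M) \<le> (\<integral>x. f k x * indicator A x \<partial>M)"
    proof (rule integral_mono_AE)
      show "AE x in M. a * indicator A x \<le> f k x * indicator A x"
        using f(2)[of k] by eventually_elim (auto simp: indicator_def)
    qed (use int int1 A in auto)
    moreover have "(\<integral>x. f k x * indicator A x \<partial>M) \<le> (\<integral>x. b * indicator A x \<partial>M)"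
    proof (rule integral_mono_AE)
      show "AE x in M. f k x * indicator A x \<le> b * indicator A x"
        using f(2)[of k] by eventually_elim (auto simp: indicator_def)
    qed (use int int1 A in auto)
    ultimately show "a * measure M A \<le> (\<integral>x. f k x * indicator A x \<partial>M)"
     "(\<integral>x. f k x * indicator A x \<partial>M) \<le> b * measure M A"
      using A by (simp_all add: sets.Int_space_eq2)
  qed
  have \<nu>_bounds: "a * measure M A \<le> \<nu> A" "\<nu> A \<le> b * measure M A" if "A \<in> sets M" for A
    using \<nu>[OF that] bounds_k[OF that] by (auto intro: LIMSEQ_le_const LIMSEQ_le_const2)
  have \<nu>_nonneg: "0 \<le> \<nu> A" if "A \<in> sets M" for A
    using \<nu>_bounds(1)[OF that] ab by (meson measure_nonneg mult_nonneg_nonneg order_trans)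
  have \<nu>_add: "\<nu> (A \<union> B) = \<nu> A + \<nu> B" if AB: "A \<in> sets M" "B \<in> sets M" "A \<inter> B = {}" for A B
  proof -
    have "(\<integral>x. f k x * indicator (A \<union> B) x \<partial>M) =
          (\<integral>x. f k x * indicator A x \<partial>M) + (\<integral>x. f k x * indicator B x \<partial>M)" for k
    proof -
      have "f k x * indicator (A \<union> B) x = f k x * indicator A x + f k x * indicator B x" for x
        using AB(3) by (auto simp: indicator_def)
      then show ?thesis
        using AB by (simp add: int)
    qed
    with \<nu>[of "A \<union> B"] tendsto_add[OF \<nu>[OF AB(1)] \<nu>[OF AB(2)]] AB show ?thesis
      by (auto intro: LIMSEQ_unique)
  qed
  have \<nu>_empty: "\<nu> {} = 0"
    using \<nu>_bounds[of "{}"] by simp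
  define N where "N = measure_of (space M) (sets M) (\<lambda>A. ennreal (\<nu> A))"
  have sets_N: "sets N = sets M"
    by (simp add: N_def)
  have "countably_additive (sets M) (\<lambda>A. ennreal (\<nu> A))"
  proof (rule sets.empty_continuous_imp_countably_additive)
    show "positive (sets M) (\<lambda>A. ennreal (\<nu> A))"
      by (simp add: positive_def \<nu>_empty)
    show "additive (sets M) (\<lambda>A. ennreal (\<nu> A))"
      by (auto simp: additive_def \<nu>_add \<nu>_nonneg)
    fix A :: "nat \<Rightarrow> 'a set" assume A: "range A \<subseteq> sets M" "decseq A" "(\<Inter>i. A i) = {}"
    have "(\<lambda>i. b * measure M (A i)) \<longlonglongrightarrow> b * measure M (\<Inter>i. A i)"
      by (intro tendsto_mult tendsto_const finite_Lim_measure_decseq A)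
    then have lim: "(\<lambda>i. b * measure M (A i)) \<longlonglongrightarrow> 0"
      by (simp add: A(3))
    have "\<forall>\<^sub>F i in sequentially. 0 \<le> \<nu> (A i)" "\<forall>\<^sub>F i in sequentially. \<nu> (A i) \<le> b * measure M (A i)"
      using A(1) by (auto intro!: always_eventually \<nu>_nonneg \<nu>_bounds)
    from this tendsto_const lim have "(\<lambda>i. \<nu> (A i)) \<longlonglongrightarrow> 0"
      by (rule tendsto_sandwich)
    then show "(\<lambda>i. ennreal (\<nu> (A i))) \<longlonglongrightarrow> 0"
      using tendsto_ennrealI[of "\<lambda>i. \<nu> (A i)" 0 sequentially] by simp
  qed simp
  then have emeasure_N: "emeasure N A = ennreal (\<nu> A)" if "A \<in> sets M" for A
    unfolding N_def using that
    by (intro emeasure_measure_of_sigma sets.sigma_algebra_axioms) (auto simp: positive_def \<nu>_empty)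
  have ac: "absolutely_continuous M N"
    unfolding absolutely_continuous_def
  proof
    fix A assume A: "A \<in> null_sets M"
    then have "A \<in> sets M" "measure M A = 0"
      by (auto simp: measure_eq_0_null_sets)
    with \<nu>_bounds[of A] show "A \<in> null_sets N"
      by (auto simp: null_sets_def sets_N emeasure_N ennreal_eq_0_iff)
  qed
  have fin_N: "finite_measure N"
    using emeasure_N[of "space M"] sets_eq_imp_space_eq[OF sets_N] by (intro finite_measureI) simp
  obtain D where D: "D \<in> borel_measurable M"
    "AE x in M. RN_deriv M N x = ennreal (D x)" "AE x in N. 0 < D x" "\<And>x. 0 \<le> D x"
    by (rule real_RN_deriv[OF fin_N ac sets_N]) (rule that)
  note [measurable] = D(1)
  have N_D: "N = density M (\<lambda>x. ennreal (D x))"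
  proof -
    have "N = density M (RN_deriv M N)"
      using density_RN_deriv[OF \<open>absolutely_continuous M N\<close> sets_N] by simp
    also have "\<dots> = density M (\<lambda>x. ennreal (D x))"
      using D(2) by (intro density_cong) auto
    finally show ?thesis .
  qed
  have nn: "(\<integral>\<^sup>+x. ennreal (D x * indicator A x) \<partial>M) = ennreal (\<nu> A)" if A: "A \<in> sets M" for A
  proof -
    have "(\<integral>\<^sup>+x. ennreal (D x * indicator A x) \<partial>M) = (\<integral>\<^sup>+x. ennreal (D x) * indicator A x \<partial>M)"
      by (intro nn_integral_cong) (auto simp: indicator_def)
    also have "\<dots> = emeasure (density M (\<lambda>x. ennreal (D x))) A"
      using A by (simp add: emeasure_density)
    also have "\<dots> = ennreal (\<nu> A)"
      using emeasure_N[OF A] N_D by simp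
    finally show ?thesis .
  qed
  have int_D: "integrable M (\<lambda>x. D x * indicator A x)" and
    integral_D: "(\<integral>x. D x * indicator A x \<partial>M) = \<nu> A" if A: "A \<in> sets M" for A
  proof -
    show "integrable M (\<lambda>x. D x * indicator A x)"
      using A nn[OF A] D(4) by (intro integrableI_nonneg) (auto simp: less_top)
    show "(\<integral>x. D x * indicator A x \<partial>M) = \<nu> A"
      using A nn[OF A] D(4) \<nu>_nonneg[OF A] by (subst integral_eq_nn_integral) auto
  qed
  have "integrable M D"
    using int_D[of "space M"] by (simp cong: Bochner_Integration.integrable_cong)
  have "AE x in M. 0 \<le> D x - a"
  proof (rule AE_nonneg_if_integrals_nonneg)
    fix A assume A: "A \<in> sets M"
    have "(\<integral>x. (D x - a) * indicator A x \<partial>M) = \<nu> A - a * measure M A"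
      using A by (simp add: left_diff_distrib int_D int1 integral_D sets.Int_space_eq2)
    then show "0 \<le> (\<integral>x. (D x - a) * indicator A x \<partial>M)"
      using \<nu>_bounds[OF A] by simp
  qed (use \<open>integrable M D\<close> in auto)
  moreover have "AE x in M. 0 \<le> b - D x"
  proof (rule AE_nonneg_if_integrals_nonneg)
    fix A assume A: "A \<in> sets M"
    have "(\<integral>x. (b - D x) * indicator A x \<partial>M) = b * measure M A - \<nu> A"
      using A by (simp add: left_diff_distrib int_D int1 integral_D sets.Int_space_eq2)
    then show "0 \<le> (\<integral>x. (b - D x) * indicator A x \<partial>M)"
      using \<nu>_bounds[OF A] by simp
  qed (use \<open>integrable M D\<close> in auto)
  ultimately have D_bounds: "AE x in M. max a (min b (D x)) = D x"
    by eventually_elim auto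
  show ?thesis
  proof
    show "(\<lambda>x. max a (min b (D x))) \<in> borel_measurable M" by measurable
    show "a \<le> max a (min b (D x))" "max a (min b (D x)) \<le> b" for x
      using ab by auto
    fix \<psi> :: "'a \<Rightarrow> real" assume "integrable M \<psi>"
    then show "(\<lambda>k. \<integral>x. f k x * \<psi> x \<partial>M) \<longlonglongrightarrow> (\<integral>x. max a (min b (D x)) * \<psi> x \<partial>M)"
    proof (rule tendsto_integral_bounded_weak[OF \<open>finite_measure M\<close> f(1) f_abs, rotated -1])
      show "AE x in M. \<bar>max a (min b (D x))\<bar> \<le> b"
        using ab by (auto intro!: AE_I2)
      fix A assume A: "A \<in> sets M"
      have "(\<integral>x. max a (min b (D x)) * indicator A x \<partial>M) = (\<integral>x. D x * indicator A x \<partial>M)"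
        using D_bounds A by (intro integral_cong_AE) auto
      then show "(\<lambda>k. \<integral>x. f k x * indicator A x \<partial>M) \<longlonglongrightarrow>
          (\<integral>x. max a (min b (D x)) * indicator A x \<partial>M)"
        using \<nu>[OF A] integral_D[OF A] by simp
    qed measurable
  qed
qed

section \<open>Bumps determine weak convergence\<close>

text \<open>
  The closed box, not only the open one, has to lie in \<open>U\<close>, since the support of a bump is closed;
  therefore the box is chosen in a ball of half the available radius.
\<close>

lemma open_eq_Union_rational_boxes:
  fixes U :: "'a::euclidean_space set"
  assumes "open U"
  shows "U = (\<Union>(a, b)\<in>rational_corner_pairs U. box a b)"
proof
  show "U \<subseteq> (\<Union>(a, b)\<in>rational_corner_pairs U. box a b)"
  proof
    fix x assume "x \<in> U"
    then obtain e where e: "e > 0" "ball x e \<subseteq> U"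
      using assms openE by blast
    obtain a b where ab: "\<forall>i\<in>Basis. a \<bullet> i \<in> \<rat> \<and> b \<bullet> i \<in> \<rat>" "x \<in> box a b" "box a b \<subseteq> ball x (e / 2)"
      using rational_boxes[of "e / 2" x] \<open>e > 0\<close> by auto
    have "cbox a b = closure (box a b)"
      using ab(2) by (subst closure_box) auto
    also have "\<dots> \<subseteq> cball x (e / 2)"
      using ab(3) by (meson ball_subset_cball closed_cball closure_minimal order_trans)
    also have "\<dots> \<subseteq> U"
      using e by (auto simp: subset_iff)
    finally show "x \<in> (\<Union>(a, b)\<in>rational_corner_pairs U. box a b)"
      using ab by (auto simp: rational_corner_pairs_def)
  qed
  show "(\<Union>(a, b)\<in>rational_corner_pairs U. box a b) \<subseteq> U"
    using box_subset_cbox by (force simp: rational_corner_pairs_def)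
qed

lemma rational_corner_pairs_mono: "U \<subseteq> V \<Longrightarrow> rational_corner_pairs U \<subseteq> rational_corner_pairs V"
  by (auto simp: rational_corner_pairs_def)

text \<open>
  Induction over the generation of the Borel sets by open sets; for an open set \<open>U\<close> the boxes
  exhausting \<open>U \<inter> \<Omega>\<close> belong to the family of \<open>\<Omega>\<close>.
\<close>

lemma rational_boxes_generate_borel:
  fixes \<Omega> :: "'a::euclidean_space set"
  assumes "open \<Omega>" "A \<in> sets borel"
  shows "A \<inter> \<Omega> \<in> sigma_sets \<Omega> {box a b | a b. (a, b) \<in> rational_corner_pairs \<Omega>}"
proof -
  let ?G = "{box a b | a b. (a, b) \<in> rational_corner_pairs \<Omega>}"
  have "?G \<subseteq> Pow \<Omega>"
    using open_eq_Union_rational_boxes[OF \<open>open \<Omega>\<close>] by blast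
  then interpret sigma_algebra \<Omega> "sigma_sets \<Omega> ?G"
    by (rule sigma_algebra_sigma_sets)
  have "A \<in> sigma_sets UNIV {S. open S}"
    using assms(2) by (simp add: borel_def)
  then show ?thesis
  proof induction
    case (Basic U)
    then have "U \<inter> \<Omega> = (\<Union>(a, b)\<in>rational_corner_pairs (U \<inter> \<Omega>). box a b)"
      using \<open>open \<Omega>\<close> by (intro open_eq_Union_rational_boxes) auto
    also have "\<dots> \<in> sigma_sets \<Omega> ?G"
      using rational_corner_pairs_mono[of "U \<inter> \<Omega>" \<Omega>]
      by (intro countable_UN' countable_rational_corner_pairs) auto
    finally show ?case .
  next
    case Empty
    then show ?case by simp
  next
    case (Compl A)
    have "(UNIV - A) \<inter> \<Omega> = \<Omega> - A \<inter> \<Omega>" by blast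
    with Compl show ?case by auto
  next
    case (Union A)
    have "(\<Union>i. A i) \<inter> \<Omega> = (\<Union>i. A i \<inter> \<Omega>)" by blast
    also have "\<dots> \<in> sigma_sets \<Omega> ?G"
      using Union.IH by (intro countable_nat_UN) blast
    finally show ?case .
  qed
qed

lemma box_Int_rational_box:
  fixes \<Omega> :: "'a::euclidean_space set"
  assumes "A \<in> {box a b | a b. (a, b) \<in> rational_corner_pairs \<Omega>}"
    "B \<in> {box a b | a b. (a, b) \<in> rational_corner_pairs \<Omega>}"
  shows "A \<inter> B \<in> {box a b | a b. (a, b) \<in> rational_corner_pairs \<Omega>}"
proof -
  obtain a b c d where AB: "A = box a b" "B = box c d"
    and ab: "\<forall>i\<in>Basis. a \<bullet> i \<in> \<rat> \<and> b \<bullet> i \<in> \<rat>" "cbox a b \<subseteq> \<Omega>"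
    and cd: "\<forall>i\<in>Basis. c \<bullet> i \<in> \<rat> \<and> d \<bullet> i \<in> \<rat>"
    using assms by (auto simp: rational_corner_pairs_def)
  let ?l = "\<Sum>i\<in>Basis. max (a \<bullet> i) (c \<bullet> i) *\<^sub>R i" and ?u = "\<Sum>i\<in>Basis. min (b \<bullet> i) (d \<bullet> i) *\<^sub>R i"
  have "A \<inter> B = box ?l ?u"
    by (auto simp: AB mem_box set_eq_iff)
  moreover have "cbox ?l ?u \<subseteq> \<Omega>"
    using ab(2) by (auto simp: mem_box subset_iff)
  moreover have "\<forall>i\<in>Basis. ?l \<bullet> i \<in> \<rat> \<and> ?u \<bullet> i \<in> \<rat>"
    using ab(1) cd by (auto simp: max_def min_def)
  ultimately show ?thesis
    unfolding rational_corner_pairs_def by blast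
qed

lemma empty_rational_box:
  fixes \<Omega> :: "'a::euclidean_space set"
  shows "(One, 0) \<in> rational_corner_pairs \<Omega>" and "{} = box One (0::'a)"
proof -
  obtain i :: 'a where "i \<in> Basis" using nonempty_Basis by blast
  then have "cbox One 0 = ({} :: 'a set)" "box One 0 = ({} :: 'a set)"
    by (auto simp: box_eq_empty)
  then show "(One, 0) \<in> rational_corner_pairs \<Omega>" and "{} = box One (0::'a)"
    by (auto simp: rational_corner_pairs_def)
qed

text \<open>
  Bumps tend to indicators of boxes, and the boxes are closed under intersection, so Dynkin's lemma
  reaches all Borel sets; almost everywhere convergence in \<open>lim\<close> then absorbs the null sets that
  distinguish Lebesgue from Borel sets. For Dynkin's complement step \<open>\<Omega>\<close> itself is needed; it is an
  increasing union of finite unions of boxes, which are obtained by inclusion and exclusion from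
  the linearity of \<open>P\<close>.
\<close>

lemma bumps_monotone_class:
  fixes \<Omega> :: "'a::euclidean_space set" and P :: "('a \<Rightarrow> real) \<Rightarrow> bool"
  assumes "open \<Omega>"
    and bumps: "\<And>\<phi>. \<phi> \<in> bumps \<Omega> \<Longrightarrow> P \<phi>"
    and lin: "\<And>f g c. P f \<Longrightarrow> P g \<Longrightarrow> P (\<lambda>x. f x + c * g x)"
    and lim: "\<And>u f. (\<And>i. P (u i)) \<Longrightarrow> (\<And>i. u i \<in> borel_measurable (lebesgue_on \<Omega>)) \<Longrightarrow>
        f \<in> borel_measurable (lebesgue_on \<Omega>) \<Longrightarrow> (\<And>i x. \<bar>u i x\<bar> \<le> 1) \<Longrightarrow>
        (AE x in lebesgue_on \<Omega>. (\<lambda>i. u i x) \<longlonglongrightarrow> f x) \<Longrightarrow> P f"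
    and A: "A \<in> sets (lebesgue_on \<Omega>)"
  shows "P (indicator A)"
proof -
  let ?G = "{box a b | a b. (a, b) \<in> rational_corner_pairs \<Omega>}"
  have \<Omega>_borel[measurable]: "\<Omega> \<in> sets borel" using \<open>open \<Omega>\<close> by simp
  have G_sub: "?G \<subseteq> Pow \<Omega>"
    using open_eq_Union_rational_boxes[OF \<open>open \<Omega>\<close>] by blast
  have meas: "indicator B \<in> borel_measurable (lebesgue_on \<Omega>)" if "B \<in> sets borel" for B :: "'a set"
    using that by (intro measurable_restrict_space1 measurable_completion) auto
  have box: "P (indicator B)" if B: "B \<in> ?G" for B
  proof -
    obtain a b where ab: "B = box a b" "(a, b) \<in> rational_corner_pairs \<Omega>" using B by blast
    then have in_bumps: "bump a b n \<in> bumps \<Omega>" for n by (auto simp: bumps_def)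
    show ?thesis unfolding ab(1)
    proof (rule lim[of "bump a b"])
      show "bump a b n \<in> borel_measurable (lebesgue_on \<Omega>)" for n
        using borel_measurable_bumps[OF in_bumps]
        by (intro measurable_restrict_space1 measurable_completion) auto
    qed (use bumps in_bumps abs_bumps_le_1[OF in_bumps] in
        \<open>auto intro!: meas bump_tendsto_indicator\<close>)
  qed
  have countable_union: "P (indicator (\<Union>i. B i))" if "\<And>n. P (indicator (\<Union>i<n. B i))" "\<And>i. B i \<in> sets borel"
    for B :: "nat \<Rightarrow> 'a set"
  proof (rule lim[of "\<lambda>n. indicator (\<Union>i<n. B i)"])
    show "AE x in lebesgue_on \<Omega>. (\<lambda>n. indicator (\<Union>i<n. B i) x) \<longlonglongrightarrow> (indicator (\<Union>i. B i) x :: real)"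
      by (intro AE_I2 LIMSEQ_indicator_UN)
  qed (use that in \<open>auto intro!: meas simp: indicator_def\<close>)
  have empty_set_P: "P (indicator {})"
  proof -
    have "({} :: 'a set) \<in> ?G"
      using empty_rational_box[where 'a = 'a] by fastforce
    then show ?thesis by (rule box)
  qed
  have G_borel: "B \<in> sets borel" if "B \<in> ?G" for B
    using that by auto
  have fin_union: "P (indicator (\<Union>i<n. B i))" if "\<And>i. B i \<in> ?G" for n and B :: "nat \<Rightarrow> 'a set"
    using that
  proof (induction n arbitrary: B)
    case 0
    then show ?case using empty_set_P by (simp only: lessThan_0 UN_empty)
  next
    case (Suc n)
    have Int: "P (indicator (\<Union>i<n. B i \<inter> B n))"
      by (intro Suc.IH box_Int_rational_box Suc.prems)
    \<comment> \<open>inclusion and exclusion for the union of the first \<open>n\<close> boxes and the box \<open>B n\<close>\<close>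
    have "P (\<lambda>x. (indicator (\<Union>i<n. B i) x + 1 * indicator (B n) x) +
        (-1) * indicator (\<Union>i<n. B i \<inter> B n) x)"
      by (rule lin[OF lin[OF Suc.IH[OF Suc.prems] box[OF Suc.prems]] Int])
    moreover have "(\<lambda>x. (indicator (\<Union>i<n. B i) x + 1 * indicator (B n) x) +
        (-1) * indicator (\<Union>i<n. B i \<inter> B n) x) = (indicator (\<Union>i<Suc n. B i) :: 'a \<Rightarrow> real)"
      by (auto simp: indicator_def less_Suc_eq fun_eq_iff)
    ultimately show ?case by simp
  qed
  have "P (indicator \<Omega>)"
  proof -
    let ?f = "\<lambda>i. case from_nat_into (rational_corner_pairs \<Omega>) i of (a, b) \<Rightarrow> box a b"
    have ne: "rational_corner_pairs \<Omega> \<noteq> {}"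
      using empty_rational_box(1) by blast
    have "\<Omega> = (\<Union>p\<in>range (from_nat_into (rational_corner_pairs \<Omega>)). case p of (a, b) \<Rightarrow> box a b)"
      unfolding range_from_nat_into[OF ne countable_rational_corner_pairs]
      by (rule open_eq_Union_rational_boxes) fact
    then have eq: "\<Omega> = (\<Union>i. ?f i)"
      by simp
    have f: "?f i \<in> ?G" for i
      using from_nat_into[OF ne, of i] by (cases "from_nat_into (rational_corner_pairs \<Omega>) i") auto
    have "P (indicator (\<Union>i. ?f i))"
    proof (rule countable_union)
      show "P (indicator (\<Union>i<n. ?f i))" for n
        by (rule fin_union) (rule f)
      show "?f i \<in> sets borel" for i
        by (rule G_borel) (rule f)
    qed
    then show ?thesis using eq by simp
  qed
  have Int_stable: "Int_stable ?G"
    unfolding Int_stable_def by (intro ballI box_Int_rational_box)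
  have borel: "P (indicator B)" if "B \<in> sigma_sets \<Omega> ?G" for B
    using Int_stable G_sub that
  proof (induction rule: sigma_sets_induct_disjoint)
    case (compl B)
    then have "P (\<lambda>x. indicator \<Omega> x + (-1) * indicator B x)"
      by (intro lin[OF \<open>P (indicator \<Omega>)\<close>])
    moreover have "B \<subseteq> \<Omega>"
      using compl(1) sigma_sets_into_sp[OF G_sub] by blast
    then have "(\<lambda>x. indicator \<Omega> x + (-1) * indicator B x) = (indicator (\<Omega> - B) :: 'a \<Rightarrow> real)"
      by (auto simp: indicator_def fun_eq_iff)
    ultimately show ?case by simp
  next
    case (union B)
    note B = union.hyps union.IH
    show ?case
    proof (rule countable_union)
      show "P (indicator (\<Union>i<n. B i))" for n
      proof (induction n)
        case 0
        then show ?case using empty_set_P by (simp only: lessThan_0 UN_empty)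
      next
        case (Suc n)
        have "P (\<lambda>x. indicator (\<Union>i<n. B i) x + 1 * indicator (B n) x)"
          by (rule lin[OF Suc B(3)])
        moreover have "B i \<inter> B n = {}" if "i < n" for i
          using B(1) that by (auto simp: disjoint_family_on_def)
        then have "(\<lambda>x. indicator (\<Union>i<n. B i) x + 1 * indicator (B n) x) =
            (indicator (\<Union>i<Suc n. B i) :: 'a \<Rightarrow> real)"
          by (fastforce simp: indicator_def less_Suc_eq fun_eq_iff)
        ultimately show ?case by simp
      qed
      have "sigma_sets \<Omega> ?G \<subseteq> sets (restrict_space borel \<Omega>)"
        using G_sub by (intro sigma_algebra.sigma_sets_subset[of \<Omega>])
           (auto simp: sets_restrict_space sets.restricted_sigma_algebra
              intro!: image_eqI[where x = "box _ _"] dest!: set_mp[of ?G])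
      then show "B i \<in> sets borel" for i
        using B(2) sets_restrict_space_iff[of \<Omega> borel "B i"] \<Omega>_borel by (simp add: subset_iff image_subset_iff)
    qed
  next
    case (basic B)
    then show ?case by (rule box)
  next
    case empty
    show ?case by (fact empty_set_P)
  qed
  have "A \<in> sets lebesgue" "A \<subseteq> \<Omega>"
    using A by (auto simp: sets_restrict_space_iff)
  then obtain S N N' where SN: "A = S \<union> N" "N \<subseteq> N'" "N' \<in> null_sets lborel" "S \<in> sets lborel"
    by (auto elim!: sets_completionE)
  then have "P (indicator (S \<inter> \<Omega>))"
    using rational_boxes_generate_borel[OF \<open>open \<Omega>\<close>] by (intro borel) auto
  show ?thesis
  proof (rule lim[of "\<lambda>_. indicator (S \<inter> \<Omega>)"])
    show "indicator A \<in> borel_measurable (lebesgue_on \<Omega>)" using A by auto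
    show "indicator (S \<inter> \<Omega>) \<in> borel_measurable (lebesgue_on \<Omega>)" 
      using SN by (intro meas) auto
    have "AE x in lebesgue. x \<notin> N'"
      using SN(3) by (intro AE_completion AE_not_in)
    then have "AE x in lebesgue_on \<Omega>. x \<notin> N'"
      by (auto simp: AE_restrict_space_iff)
    then show "AE x in lebesgue_on \<Omega>. (\<lambda>i. indicator (S \<inter> \<Omega>) x) \<longlonglongrightarrow> (indicator A x :: real)"
      by eventually_elim (use SN \<open>A \<subseteq> \<Omega>\<close> in \<open>auto simp: indicator_def\<close>)
  qed (use \<open>P (indicator (S \<inter> \<Omega>))\<close> in \<open>auto simp: indicator_def\<close>)
qed

text \<open>
  Equality of the pairings is linear and, by dominated convergence with majorant \<open>|f|\<close> or \<open>|g|\<close>,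
  stable under bounded limits.
\<close>

lemma AE_eq_if_bump_integrals_eq:
  fixes f g :: "'a::euclidean_space \<Rightarrow> real"
  assumes "open \<Omega>" and f: "integrable (lebesgue_on \<Omega>) f" and g: "integrable (lebesgue_on \<Omega>) g"
    and eq: "\<And>\<phi>. \<phi> \<in> bumps \<Omega> \<Longrightarrow> L2_inner \<Omega> f \<phi> = L2_inner \<Omega> g \<phi>"
  shows "AE x in lebesgue_on \<Omega>. f x = g x"
proof (rule AE_eq_if_integrals_eq[OF f g])
  let ?M = "lebesgue_on \<Omega>"
  define P where "P \<psi> \<longleftrightarrow> integrable ?M (\<lambda>x. f x * \<psi> x) \<and> integrable ?M (\<lambda>x. g x * \<psi> x) \<and>
    (\<integral>x. f x * \<psi> x \<partial>?M) = (\<integral>x. g x * \<psi> x \<partial>?M)" for \<psi> :: "'a \<Rightarrow> real"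
  have int: "integrable ?M (\<lambda>x. h x * \<psi> x)"
    if "integrable ?M h" "\<psi> \<in> borel_measurable ?M" "AE x in ?M. \<bar>\<psi> x\<bar> \<le> 1" for h \<psi> :: "'a \<Rightarrow> real"
    using integrable_bounded_mult[OF that] by (simp add: mult.commute)
  fix A assume "A \<in> sets ?M"
  from this \<open>open \<Omega>\<close> have "P (indicator A)"
  proof (rule bumps_monotone_class[rotated -1])
    fix \<phi> assume \<phi>: "\<phi> \<in> bumps \<Omega>"
    then have "\<phi> \<in> borel_measurable ?M"
      by (intro measurable_restrict_space1 measurable_completion) (auto dest: borel_measurable_bumps)
    with \<phi> eq[OF \<phi>] show "P \<phi>"
      by (auto simp: P_def L2_inner_def intro!: int f g abs_bumps_le_1)
  next
    fix \<phi> \<psi> c assume "P \<phi>" "P \<psi>"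
    then show "P (\<lambda>x. \<phi> x + c * \<psi> x)"
      by (simp add: P_def distrib_left mult.left_commute[of _ c])
  next
    fix u \<psi> assume Pu: "\<And>i. P (u i)" and u: "\<And>i. u i \<in> borel_measurable ?M" "\<And>i x. \<bar>u i x\<bar> \<le> 1"
      and \<psi>: "\<psi> \<in> borel_measurable ?M" and lim: "AE x in ?M. (\<lambda>i. u i x) \<longlonglongrightarrow> \<psi> x"
    have "AE x in ?M. \<bar>\<psi> x\<bar> \<le> 1"
      using lim by eventually_elim (rule LIMSEQ_le_const2[OF tendsto_rabs], use u in auto)
    then have intp: "integrable ?M (\<lambda>x. f x * \<psi> x)" "integrable ?M (\<lambda>x. g x * \<psi> x)"
      by (auto intro!: int f g \<psi>)
    have conv: "(\<lambda>i. \<integral>x. h x * u i x \<partial>?M) \<longlonglongrightarrow> (\<integral>x. h x * \<psi> x \<partial>?M)" if h: "integrable ?M h" for h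
    proof (rule integral_dominated_convergence[where w = "\<lambda>x. \<bar>h x\<bar>"])
      show "AE x in ?M. (\<lambda>i. h x * u i x) \<longlonglongrightarrow> h x * \<psi> x"
        using lim by eventually_elim (intro tendsto_mult tendsto_const)
      show "AE x in ?M. norm (h x * u i x) \<le> \<bar>h x\<bar>" for i
        using u(2) by (auto simp: abs_mult intro!: mult_left_le)
    qed (use h u \<psi> in auto)
    have "(\<integral>x. f x * \<psi> x \<partial>?M) = (\<integral>x. g x * \<psi> x \<partial>?M)"
      using conv[OF f] conv[OF g] Pu by (auto simp: P_def intro: LIMSEQ_unique)
    with intp show "P \<psi>" by (simp add: P_def)
  qed
  then show "(\<integral>x. f x * indicator A x \<partial>?M) = (\<integral>x. g x * indicator A x \<partial>?M)"
    by (simp add: P_def)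
qed

text \<open>
  The pairings with \<open>\<psi>\<close> depend on \<open>\<psi>\<close> in an \<open>L\<^sup>1\<close>-Lipschitz way, uniformly in \<open>k\<close>, and on a finite
  measure space bounded almost everywhere convergence implies \<open>L\<^sup>1\<close> convergence; so convergence of
  the pairings is a property to which the monotone class argument applies.
\<close>

lemma weak_limit_if_bump_integrals_converge:
  fixes f :: "nat \<Rightarrow> 'a::euclidean_space \<Rightarrow> real"
  assumes "open \<Omega>" and fin: "finite_measure (lebesgue_on \<Omega>)" and ab: "0 \<le> a" "a \<le> b"
    and f: "\<And>k. f k \<in> borel_measurable (lebesgue_on \<Omega>)"
      "\<And>k. AE x in lebesgue_on \<Omega>. a \<le> f k x \<and> f k x \<le> b"
    and conv: "\<And>\<phi>. \<phi> \<in> bumps \<Omega> \<Longrightarrow> convergent (\<lambda>k. L2_inner \<Omega> (f k) \<phi>)"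
  obtains g where "g \<in> borel_measurable (lebesgue_on \<Omega>)" "\<And>x. a \<le> g x" "\<And>x. g x \<le> b"
    "\<And>\<psi>. integrable (lebesgue_on \<Omega>) \<psi> \<Longrightarrow> (\<lambda>k. L2_inner \<Omega> (f k) \<psi>) \<longlonglongrightarrow> L2_inner \<Omega> g \<psi>"
proof -
  let ?M = "lebesgue_on \<Omega>"
  interpret finite_measure ?M by fact
  have f_abs: "AE x in ?M. \<bar>f k x\<bar> \<le> b" for k
    using f(2)[of k] by eventually_elim (use ab in auto)
  define P where "P \<psi> \<longleftrightarrow> integrable ?M \<psi> \<and> convergent (\<lambda>k. \<integral>x. f k x * \<psi> x \<partial>?M)"
    for \<psi> :: "'a \<Rightarrow> real"
  have int: "integrable ?M \<psi>" if "\<psi> \<in> borel_measurable ?M" "AE x in ?M. \<bar>\<psi> x\<bar> \<le> 1" for \<psi> :: "'a \<Rightarrow> real"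
    using that by (intro integrable_const_bound[of _ 1]) auto
  have "P (indicator A)" if "A \<in> sets ?M" for A
    using that \<open>open \<Omega>\<close>
  proof (rule bumps_monotone_class[rotated -1])
    fix \<phi> assume \<phi>: "\<phi> \<in> bumps \<Omega>"
    then have "\<phi> \<in> borel_measurable ?M"
      by (intro measurable_restrict_space1 measurable_completion) (auto dest: borel_measurable_bumps)
    with \<phi> conv[OF \<phi>] show "P \<phi>"
      by (auto simp: P_def L2_inner_def intro!: int abs_bumps_le_1)
  next
    fix \<phi> \<psi> c assume "P \<phi>" "P \<psi>"
    then have int: "integrable ?M \<phi>" "integrable ?M \<psi>" 
      and conv: "convergent (\<lambda>k. (\<integral>x. f k x * \<phi> x \<partial>?M) + c * (\<integral>x. f k x * \<psi> x \<partial>?M))"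
      by (auto simp: P_def intro!: convergent_add convergent_mult convergent_const)
    have "(\<integral>x. f k x * (\<phi> x + c * \<psi> x) \<partial>?M) =
        (\<integral>x. f k x * \<phi> x \<partial>?M) + c * (\<integral>x. f k x * \<psi> x \<partial>?M)" for k
      using integrable_bounded_mult[OF int(1) f(1) f_abs] integrable_bounded_mult[OF int(2) f(1) f_abs]
      by (simp add: distrib_left mult.left_commute[of _ c])
    with int conv show "P (\<lambda>x. \<phi> x + c * \<psi> x)"
      by (simp add: P_def)
  next
    fix u \<psi> assume Pu: "\<And>i. P (u i)" and u: "\<And>i. u i \<in> borel_measurable ?M" "\<And>i x. \<bar>u i x\<bar> \<le> 1"
      and \<psi>: "\<psi> \<in> borel_measurable ?M" and lim: "AE x in ?M. (\<lambda>i. u i x) \<longlonglongrightarrow> \<psi> x"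
    have \<psi>1: "AE x in ?M. \<bar>\<psi> x\<bar> \<le> 1"
      using lim by eventually_elim (rule LIMSEQ_le_const2[OF tendsto_rabs], use u in auto)
    have intu: "integrable ?M (u i)" for i
      using u by (intro int) auto
    have int\<psi>: "integrable ?M \<psi>"
      by (intro int \<psi> \<psi>1)
    define e where "e i = b * (\<integral>x. \<bar>u i x - \<psi> x\<bar> \<partial>?M)" for i
    have "(\<lambda>i. \<integral>x. \<bar>u i x - \<psi> x\<bar> \<partial>?M) \<longlonglongrightarrow> (\<integral>x. 0 \<partial>?M)"
    proof (rule integral_dominated_convergence[where w = "\<lambda>_. 2"])
      show "AE x in ?M. (\<lambda>i. \<bar>u i x - \<psi> x\<bar>) \<longlonglongrightarrow> 0"
        using lim by eventually_elim (intro tendsto_rabs_zero LIM_zero)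
      show "AE x in ?M. norm \<bar>u i x - \<psi> x\<bar> \<le> 2" for i
        using \<psi>1
      proof eventually_elim
        case (elim x)
        then show ?case
          using u(2)[of i x] abs_triangle_ineq4[of "u i x" "\<psi> x"] by simp
      qed
    qed (use u \<psi> in auto)
    then have "e \<longlonglongrightarrow> 0"
      unfolding e_def by (auto intro: tendsto_mult_right_zero)
    have "convergent (\<lambda>k. \<integral>x. f k x * \<psi> x \<partial>?M)"
    proof (rule convergent_uniform_approx[OF _ _ \<open>e \<longlonglongrightarrow> 0\<close>])
      show "convergent (\<lambda>k. \<integral>x. f k x * u i x \<partial>?M)" for i
        using Pu by (simp add: P_def)
      show "\<bar>(\<integral>x. f k x * u i x \<partial>?M) - (\<integral>x. f k x * \<psi> x \<partial>?M)\<bar> \<le> e i" for i k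
      proof -
        have "(\<integral>x. f k x * u i x \<partial>?M) - (\<integral>x. f k x * \<psi> x \<partial>?M) = (\<integral>x. f k x * (u i x - \<psi> x) \<partial>?M)"
          using integrable_bounded_mult[OF intu f(1) f_abs] integrable_bounded_mult[OF int\<psi> f(1) f_abs]
          by (simp add: right_diff_distrib)
        then show ?thesis
          using integral_bounded_mult_le[of ?M "\<lambda>x. u i x - \<psi> x" "f k" b] f(1) f_abs intu int\<psi>
          by (simp add: e_def)
      qed
    qed
    with int\<psi> show "P \<psi>" by (simp add: P_def)
  qed
  then have "convergent (\<lambda>k. \<integral>x. f k x * indicator A x \<partial>?M)" if "A \<in> sets ?M" for A
    using that by (simp add: P_def)
  from bounded_weak_limit_exists[OF fin ab f this] show ?thesis
    using that unfolding L2_inner_def by blast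
qed

section \<open>Product domains and slices in time\<close>

lemma integral_lebesgue_on_eq_lborel:
  fixes f :: "'a::euclidean_space \<Rightarrow> real"
  assumes "\<Omega> \<in> sets borel" "f \<in> borel_measurable borel"
  shows "(\<integral>x. f x \<partial>lebesgue_on \<Omega>) = (\<integral>x. indicator \<Omega> x * f x \<partial>lborel)"
  using assms by (simp add: integral_restrict_space integral_completion)

lemma borel_measurable_slice_integral:
  fixes \<psi> :: "'b::euclidean_space \<times> 'a::euclidean_space \<Rightarrow> real"
  assumes [measurable]: "\<Omega> \<in> sets borel" "\<psi> \<in> borel_measurable borel"
  shows "(\<lambda>t. \<integral>x. \<psi> (t, x) \<partial>lebesgue_on \<Omega>) \<in> borel_measurable borel"
proof -
  have "(\<lambda>x. \<psi> (t, x)) \<in> borel_measurable borel" for t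
    by simp
  then have "(\<lambda>t. \<integral>x. \<psi> (t, x) \<partial>lebesgue_on \<Omega>) = (\<lambda>t. \<integral>x. indicator \<Omega> x * \<psi> (t, x) \<partial>lborel)"
    by (intro ext integral_lebesgue_on_eq_lborel) auto
  moreover have "(\<lambda>t. \<integral>x. indicator \<Omega> x * \<psi> (t, x) \<partial>lborel) \<in> borel_measurable borel"
    by measurable
  ultimately show ?thesis by simp
qed

lemma finite_measure_restrict_lborel:
  assumes "bounded S" "S \<in> sets borel"
  shows "finite_measure (restrict_space lborel S)"
  using assms emeasure_bounded_finite[of S]
  by (intro finite_measureI) (auto simp: emeasure_restrict_space space_restrict_space)

text \<open>
  The mixture of measures is deliberate: on the product and in \<open>t\<close> only Borel functions occur, and
  Fubini is available for the Borel restriction of Lebesgue measure, whose product structure is lost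
  under completion; in \<open>x\<close> the completed measure is the one of the pairing \<open>L2_inner\<close>.
\<close>

lemma integral_restrict_lborel_Times:
  fixes \<psi> :: "'b::euclidean_space \<times> 'a::euclidean_space \<Rightarrow> real"
  assumes S: "bounded S" "S \<in> sets borel" and \<Omega>: "bounded \<Omega>" "\<Omega> \<in> sets borel"
    and \<psi>: "\<psi> \<in> borel_measurable borel" and bound: "\<And>z. \<bar>\<psi> z\<bar> \<le> C"
  shows "(\<integral>z. \<psi> z \<partial>restrict_space lborel (S \<times> \<Omega>)) =
         (\<integral>t. (\<integral>x. \<psi> (t, x) \<partial>lebesgue_on \<Omega>) \<partial>restrict_space lborel S)"
proof -
  note [measurable] = S(2) \<Omega>(2) \<psi>
  have Q: "S \<times> \<Omega> \<in> sets borel" "bounded (S \<times> \<Omega>)"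
    using S \<Omega> by (auto simp: borel_Times bounded_Times)
  interpret Q: finite_measure "restrict_space lborel (S \<times> \<Omega>)"
    by (rule finite_measure_restrict_lborel) (use Q in auto)
  have "integrable (restrict_space lborel (S \<times> \<Omega>)) \<psi>"
    using bound by (intro Q.integrable_const_bound[of _ C]) (auto intro!: measurable_restrict_space1)
  then have int: "integrable (lborel \<Otimes>\<^sub>M lborel) (\<lambda>z. indicator (S \<times> \<Omega>) z * \<psi> z)"
    using Q by (simp add: integrable_restrict_space lborel_prod)
  have inner: "(\<integral>x. indicator (S \<times> \<Omega>) (t, x) * \<psi> (t, x) \<partial>lborel) =
      indicator S t * (\<integral>x. \<psi> (t, x) \<partial>lebesgue_on \<Omega>)" for t
    by (subst integral_lebesgue_on_eq_lborel) (auto simp: indicator_times mult.assoc)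
  have "(\<integral>z. \<psi> z \<partial>restrict_space lborel (S \<times> \<Omega>)) = (\<integral>z. indicator (S \<times> \<Omega>) z * \<psi> z \<partial>(lborel \<Otimes>\<^sub>M lborel))"
    using Q by (simp add: integral_restrict_space lborel_prod)
  also have "\<dots> = (\<integral>t. (\<integral>x. indicator (S \<times> \<Omega>) (t, x) * \<psi> (t, x) \<partial>lborel) \<partial>lborel)"
    by (rule lborel_pair.integral_fst'[OF int, symmetric])
  also have "\<dots> = (\<integral>t. (\<integral>x. \<psi> (t, x) \<partial>lebesgue_on \<Omega>) \<partial>restrict_space lborel S)"
    by (simp add: inner integral_restrict_space)
  finally show ?thesis .
qed

lemma AE_lebesgue_on_Times_slices:
  fixes S :: "'b::euclidean_space set" and \<Omega> :: "'a::euclidean_space set"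
  assumes "S \<in> sets borel" "\<Omega> \<in> sets borel" and "AE z in lebesgue_on (S \<times> \<Omega>). P z"
  shows "AE t in restrict_space lborel S. AE x in lebesgue_on \<Omega>. P (t, x)"
proof -
  have "S \<times> \<Omega> \<in> sets borel" using assms by (simp add: borel_Times)
  then have "AE z in (lborel \<Otimes>\<^sub>M lborel). z \<in> S \<times> \<Omega> \<longrightarrow> P z"
    unfolding lborel_prod using assms(3) by (simp add: AE_restrict_space_iff AE_completion_iff)
  then have "AE t in lborel. AE x in lborel. (t, x) \<in> S \<times> \<Omega> \<longrightarrow> P (t, x)"
    by (rule lborel_pair.AE_pair)
  then have "AE t in lborel. t \<in> S \<longrightarrow> (AE x in lborel. x \<in> \<Omega> \<longrightarrow> P (t, x))"
    by (auto elim!: eventually_mono)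
  with assms(1,2) show ?thesis
    by (simp add: AE_restrict_space_iff AE_completion_iff)
qed

lemma AE_slices_imp_AE_lebesgue_on_Times:
  fixes S :: "'b::euclidean_space set" and \<Omega> :: "'a::euclidean_space set"
  assumes "S \<in> sets borel" "\<Omega> \<in> sets borel" and "AE t in restrict_space lborel S. P t"
  shows "AE z in lebesgue_on (S \<times> \<Omega>). P (fst z)"
proof -
  have "AE t in lborel. t \<in> S \<longrightarrow> P t"
    using assms by (simp add: AE_restrict_space_iff)
  then obtain N where N: "{t. \<not> (t \<in> S \<longrightarrow> P t)} \<subseteq> N" "N \<in> sets borel" "emeasure lborel N = 0"
    by (auto elim!: AE_E)
  have "AE z in (lborel \<Otimes>\<^sub>M (lborel :: 'a measure)). fst z \<notin> N"
  proof (rule lborel_pair.AE_pair_measure)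
    show "{z \<in> space (lborel \<Otimes>\<^sub>M (lborel :: 'a measure)). fst z \<notin> N} \<in> sets (lborel \<Otimes>\<^sub>M lborel)"
      using N(2) by measurable
    show "AE t in lborel. AE x in (lborel :: 'a measure). fst (t, x) \<notin> N"
      using AE_not_in[of N lborel] N by (auto simp: null_sets_def)
  qed
  then have "AE z in (lebesgue :: ('b \<times> 'a) measure). fst z \<notin> N"
    unfolding lborel_prod by (simp add: AE_completion_iff)
  moreover have "S \<times> \<Omega> \<in> sets borel" using assms by (simp add: borel_Times)
  ultimately show ?thesis
    using N(1) by (auto simp: AE_restrict_space_iff elim!: eventually_mono)
qed

text \<open>
  A Lebesgue measurable function on the product may have non-measurable slices; a Borel
  representative does not, and can be clamped so that its bounds hold everywhere.
\<close>

lemma bounded_borel_representative: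
  fixes u :: "'a::euclidean_space \<Rightarrow> real"
  assumes Q: "Q \<in> sets borel" and "u \<in> borel_measurable (lebesgue_on Q)"
    and "a \<le> b" "AE z in lebesgue_on Q. a \<le> u z \<and> u z \<le> b"
  obtains r where "r \<in> borel_measurable borel" "\<And>z. a \<le> r z" "\<And>z. r z \<le> b"
    "AE z in lebesgue_on Q. u z = r z"
proof -
  have "(\<lambda>z. indicator Q z *\<^sub>R u z) \<in> borel_measurable lebesgue"
    using assms by (subst borel_measurable_restrict_space_iff[symmetric]) auto
  then obtain v where v: "v \<in> borel_measurable lborel" "AE z in lborel. indicator Q z *\<^sub>R u z = v z"
    using completion_ex_borel_measurable_real by blast
  have "AE z in lebesgue. z \<in> Q \<longrightarrow> u z = v z"
    unfolding AE_completion_iff using v(2) by eventually_elim (auto simp: indicator_def)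
  then have uv: "AE z in lebesgue_on Q. u z = v z"
    using Q by (simp add: AE_restrict_space_iff)
  show ?thesis
  proof
    show "(\<lambda>z. max a (min b (v z))) \<in> borel_measurable borel"
      using v(1) by simp
    show "AE z in lebesgue_on Q. u z = max a (min b (v z))"
      using uv assms(4) by eventually_elim auto
  qed (use \<open>a \<le> b\<close> in auto)
qed

lemma L2_imp_integrable:
  assumes "finite_measure (lebesgue_on \<Omega>)" "f \<in> L2 \<Omega>"
  shows "integrable (lebesgue_on \<Omega>) f"
proof -
  interpret finite_measure "lebesgue_on \<Omega>" by fact
  show ?thesis
  proof (rule Bochner_Integration.integrable_bound[of _ "\<lambda>x. 1 + (f x)\<^sup>2"])
    show "integrable (lebesgue_on \<Omega>) (\<lambda>x. 1 + (f x)\<^sup>2)"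
      using assms by (simp add: L2_def)
    have "\<bar>y\<bar> \<le> 1 + y\<^sup>2" for y :: real
      using zero_le_power2[of "\<bar>y\<bar> - 1"] zero_le_power2[of y] unfolding power2_diff power2_abs by simp
    then show "AE x in lebesgue_on \<Omega>. norm (f x) \<le> norm (1 + (f x)\<^sup>2)"
      by (simp add: add_nonneg_nonneg)
  qed (use assms in \<open>simp add: L2_def\<close>)
qed

lemma bounded_imp_L2:
  assumes "finite_measure (lebesgue_on \<Omega>)" "f \<in> borel_measurable (lebesgue_on \<Omega>)"
    "\<And>x. \<bar>f x\<bar> \<le> C"
  shows "f \<in> L2 \<Omega>"
proof -
  interpret finite_measure "lebesgue_on \<Omega>" by fact
  have "norm ((f x)\<^sup>2) \<le> C\<^sup>2" for x
    using power_mono[OF assms(3)[of x], of 2] by simp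
  then show ?thesis
    using assms(2) unfolding L2_def by (auto intro!: integrable_const_bound[of _ "C\<^sup>2"])
qed

lemma L2_inner_cong_AE:
  assumes "f \<in> borel_measurable (lebesgue_on \<Omega>)" "g \<in> borel_measurable (lebesgue_on \<Omega>)"
    "\<psi> \<in> borel_measurable (lebesgue_on \<Omega>)" "AE x in lebesgue_on \<Omega>. f x = g x"
  shows "L2_inner \<Omega> f \<psi> = L2_inner \<Omega> g \<psi>"
  unfolding L2_inner_def using assms(4)
  by (intro integral_cong_AE) (use assms in auto)

lemma integrable_bumps:
  assumes "finite_measure (lebesgue_on \<Omega>)" "\<phi> \<in> bumps \<Omega>"
  shows "integrable (lebesgue_on \<Omega>) \<phi>"
proof -
  interpret finite_measure "lebesgue_on \<Omega>" by fact
  have "\<phi> \<in> borel_measurable (lebesgue_on \<Omega>)"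
    by (intro measurable_restrict_space1 measurable_completion) (use assms in \<open>auto dest: borel_measurable_bumps\<close>)
  with assms show ?thesis
    by (intro integrable_const_bound[of _ 1]) (auto intro: abs_bumps_le_1)
qed

text \<open>
  A set of full measure in \<open>[0,T]\<close> is dense, so \<open>t\<close> is a limit of times \<open>s n\<close> at which the bounds
  hold. The slices \<open>u (s n)\<close> have a weak limit \<open>g\<close> with the same bounds, and continuity of the
  pairings identifies it with \<open>u t\<close>.
\<close>

lemma bounds_at_every_time:
  fixes u :: "real \<Rightarrow> 'a::euclidean_space \<Rightarrow> real"
  assumes "open \<Omega>" "finite_measure (lebesgue_on \<Omega>)" "0 \<le> a" "a \<le> b" "T > 0"
    and u: "\<And>t. t \<in> {0..T} \<Longrightarrow> integrable (lebesgue_on \<Omega>) (u t)"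
    and bounds: "AE t in restrict_space lborel {0..T}. AE x in lebesgue_on \<Omega>. a \<le> u t x \<and> u t x \<le> b"
    and cont: "\<And>\<phi>. \<phi> \<in> bumps \<Omega> \<Longrightarrow> continuous_on {0..T} (\<lambda>t. L2_inner \<Omega> (u t) \<phi>)"
    and t: "t \<in> {0..T}"
  shows "AE x in lebesgue_on \<Omega>. a \<le> u t x \<and> u t x \<le> b"
proof -
  let ?ok = "\<lambda>t. AE x in lebesgue_on \<Omega>. a \<le> u t x \<and> u t x \<le> b"
  have "\<exists>s\<in>{0..T}. dist s t < e \<and> ?ok s" if "e > 0" for e
  proof (rule ccontr)
    assume neg: "\<not> ?thesis"
    let ?J = "{max 0 (t - e)<..<min T (t + e)}"
    have "AE s in lborel. s \<in> {0..T} \<longrightarrow> ?ok s"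
      using bounds by (subst (asm) AE_restrict_space_iff) auto
    then have "AE s in lborel. s \<notin> ?J"
    proof eventually_elim
      case (elim s)
      with neg show ?case by (auto simp: dist_real_def abs_if split: if_splits)
    qed
    then have "?J \<in> null_sets lborel"
      by (subst AE_iff_null_sets) auto
    moreover have pos: "max 0 (t - e) < min T (t + e)"
      using \<open>e > 0\<close> \<open>T > 0\<close> t by auto
    have "emeasure lborel ?J = ennreal (min T (t + e) - max 0 (t - e))"
      using pos by (intro emeasure_lborel_Ioo) simp
    ultimately show False
      using pos by (simp only: null_sets_def mem_Collect_eq ennreal_eq_0_iff) linarith
  qed
  then have "\<exists>s\<in>{0..T}. dist s t < 1 / real (Suc n) \<and> ?ok s" for n
    by simp
  then obtain s where s: "\<And>n. s n \<in> {0..T}" "\<And>n. dist (s n) t < 1 / real (Suc n)" "\<And>n. ?ok (s n)"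
    by metis
  have "s \<longlonglongrightarrow> t"
  proof (rule metric_LIMSEQ_I)
    fix r :: real assume "r > 0"
    then obtain N where N: "1 / real (Suc N) < r"
      using nat_approx_posE by blast
    have "dist (s n) t < r" if "n \<ge> N" for n
    proof -
      have "dist (s n) t < 1 / real (Suc n)" by (rule s)
      also have "\<dots> \<le> 1 / real (Suc N)" using that by (simp add: frac_le)
      finally show ?thesis using N by simp
    qed
    then show "\<exists>no. \<forall>n\<ge>no. dist (s n) t < r" by blast
  qed
  have lim: "(\<lambda>n. L2_inner \<Omega> (u (s n)) \<phi>) \<longlonglongrightarrow> L2_inner \<Omega> (u t) \<phi>" if "\<phi> \<in> bumps \<Omega>" for \<phi>
    by (rule continuous_on_tendsto_compose[OF cont[OF that] \<open>s \<longlonglongrightarrow> t\<close> t])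
       (intro always_eventually allI s)
  obtain g where g: "g \<in> borel_measurable (lebesgue_on \<Omega>)" "\<And>x. a \<le> g x" "\<And>x. g x \<le> b"
    "\<And>\<psi>. integrable (lebesgue_on \<Omega>) \<psi> \<Longrightarrow> (\<lambda>n. L2_inner \<Omega> (u (s n)) \<psi>) \<longlonglongrightarrow> L2_inner \<Omega> g \<psi>"
  proof (rule weak_limit_if_bump_integrals_converge[of \<Omega> a b "\<lambda>n. u (s n)"])
    show "u (s n) \<in> borel_measurable (lebesgue_on \<Omega>)" for n
      using u s by blast
    show "convergent (\<lambda>n. L2_inner \<Omega> (u (s n)) \<phi>)" if "\<phi> \<in> bumps \<Omega>" for \<phi>
      using lim[OF that] by (rule convergentI)
  qed (use assms s in auto)
  interpret finite_measure "lebesgue_on \<Omega>" by fact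
  have "AE x in lebesgue_on \<Omega>. u t x = g x"
  proof (rule AE_eq_if_bump_integrals_eq[OF \<open>open \<Omega>\<close> u[OF t]])
    show "integrable (lebesgue_on \<Omega>) g"
    proof (rule integrable_const_bound[of _ b])
      have "\<bar>g x\<bar> \<le> b" for x
        using g(2)[of x] g(3)[of x] \<open>0 \<le> a\<close> by auto
      then show "AE x in lebesgue_on \<Omega>. norm (g x) \<le> b" by simp
    qed (rule g(1))
    show "L2_inner \<Omega> (u t) \<phi> = L2_inner \<Omega> g \<phi>" if "\<phi> \<in> bumps \<Omega>" for \<phi>
      using lim[OF that] g(4)[OF integrable_bumps[OF \<open>finite_measure (lebesgue_on \<Omega>)\<close> that]]
      by (rule LIMSEQ_unique)
  qed
  then show ?thesis
    by eventually_elim (use g in auto)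
qed

text \<open>
  The usual step from a dense set to the whole space in the Arzela-Ascoli theorem.
\<close>

lemma equicontinuous_convergent:
  fixes F :: "nat \<Rightarrow> 'a::metric_space \<Rightarrow> real"
  assumes eq: "equicontinuous_family_on S F" and D: "D \<subseteq> S" "S \<subseteq> closure D"
    and conv: "\<And>t. t \<in> D \<Longrightarrow> convergent (\<lambda>k. F k t)" and t: "t \<in> S"
  shows "convergent (\<lambda>k. F k t)"
proof (rule Cauchy_convergent, rule metric_CauchyI)
  fix e :: real assume "e > 0"
  then obtain \<delta> where \<delta>: "\<delta> > 0" "\<And>k s. s \<in> S \<Longrightarrow> dist s t < \<delta> \<Longrightarrow> dist (F k s) (F k t) < e / 3"
    using eq t unfolding equicontinuous_family_on_def by (metis divide_pos_pos zero_less_numeral)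
  obtain s where s: "s \<in> D" "dist s t < \<delta>"
    using t D(2) \<delta>(1) by (meson closure_approachable subsetD)
  obtain N where N: "\<And>m n. m \<ge> N \<Longrightarrow> n \<ge> N \<Longrightarrow> dist (F m s) (F n s) < e / 3"
    using convergent_Cauchy[OF conv[OF s(1)]] \<open>e > 0\<close> by (meson metric_CauchyD divide_pos_pos zero_less_numeral)
  have "dist (F m t) (F n t) < e" if "m \<ge> N" "n \<ge> N" for m n
  proof -
    have "s \<in> S" using s D by blast
    then show ?thesis
      using N[OF that] \<delta>(2)[OF _ s(2), of m] \<delta>(2)[OF _ s(2), of n] unfolding dist_real_def by argo
  qed
  then show "\<exists>M. \<forall>m\<ge>M. \<forall>n\<ge>M. dist (F m t) (F n t) < e" by blast
qed

lemma equicontinuous_imp_continuous: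
  assumes "equicontinuous_family_on S F"
  shows "continuous_on S (F k)"
  using assms unfolding equicontinuous_family_on_def continuous_on_iff by blast

lemma equicontinuous_subfamily:
  assumes "equicontinuous_family_on S F"
  shows "equicontinuous_family_on S (\<lambda>k. F (\<sigma> k))"
  unfolding equicontinuous_family_on_def
proof (intro ballI allI impI)
  fix t and e :: real assume "t \<in> S" "e > 0"
  then obtain d where "d > 0" "\<forall>k. \<forall>s\<in>S. dist s t < d \<longrightarrow> dist (F k s) (F k t) < e"
    using assms unfolding equicontinuous_family_on_def by blast
  then show "\<exists>d>0. \<forall>k. \<forall>s\<in>S. dist s t < d \<longrightarrow> dist (F (\<sigma> k) s) (F (\<sigma> k) t) < e"
    by blast
qed

section \<open>Joint measurability and the compactness theorem\<close>

text \<open>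
  By Fubini, \<open>\<integral> r\<^sub>k \<psi>\<close> over the product is the integral over \<open>t\<close> of pairings that converge for almost
  every \<open>t\<close> and are uniformly bounded, so it converges and the \<open>r\<^sub>k\<close> have a weak limit \<open>g\<close> on the
  product. Testing with \<open>\<psi>(t, x) = 1\<^sub>J(t) \<phi>(x)\<close> for all Borel \<open>J\<close> shows that \<open>g(t, \<cdot>)\<close> and \<open>R t\<close>
  have the same pairing with \<open>\<phi>\<close> for almost every \<open>t\<close>. The exceptional null set depends on \<open>\<phi>\<close>,
  which is harmless for the countably many bumps.
\<close>

lemma jointly_measurable_weak_limit:
  fixes r :: "nat \<Rightarrow> 'b::euclidean_space \<times> 'a::euclidean_space \<Rightarrow> real" and R :: "'b \<Rightarrow> 'a \<Rightarrow> real"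
  assumes S: "bounded S" "S \<in> sets borel" and \<Omega>: "bounded \<Omega>" "open \<Omega>" and ab: "0 \<le> a" "a \<le> b"
    and r: "\<And>k. r k \<in> borel_measurable borel" "\<And>k z. a \<le> r k z" "\<And>k z. r k z \<le> b"
    and R: "\<And>t. t \<in> S \<Longrightarrow> R t \<in> borel_measurable (lebesgue_on \<Omega>)"
      "\<And>t x. t \<in> S \<Longrightarrow> a \<le> R t x" "\<And>t x. t \<in> S \<Longrightarrow> R t x \<le> b"
    and slices: "AE t in restrict_space lborel S. \<forall>\<psi>. integrable (lebesgue_on \<Omega>) \<psi> \<longrightarrow>
      (\<lambda>k. L2_inner \<Omega> (\<lambda>x. r k (t, x)) \<psi>) \<longlonglongrightarrow> L2_inner \<Omega> (R t) \<psi>"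
  obtains g where "g \<in> borel_measurable borel" "\<And>z. a \<le> g z" "\<And>z. g z \<le> b"
    "AE t in restrict_space lborel S. AE x in lebesgue_on \<Omega>. g (t, x) = R t x"
proof -
  let ?M = "lebesgue_on \<Omega>" and ?L = "restrict_space lborel S" and ?Q = "restrict_space lborel (S \<times> \<Omega>)"
  have \<Omega>_borel: "\<Omega> \<in> sets borel" using \<Omega> by simp
  have Q_borel: "S \<times> \<Omega> \<in> sets borel" using S \<Omega>_borel by (simp add: borel_Times)
  have fin_M: "finite_measure ?M"
    using \<Omega> by (intro finite_measure_lebesgue_on lmeasurable_open)
  have fin_L: "finite_measure ?L"
    using S by (rule finite_measure_restrict_lborel)
  have fin_Q: "finite_measure ?Q"
    using S \<Omega> Q_borel by (intro finite_measure_restrict_lborel) (auto simp: bounded_Times)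
  interpret M: finite_measure ?M by fact
  interpret L: finite_measure ?L by fact
  interpret Q: finite_measure ?Q by fact
  have slice_meas: "(\<lambda>x. \<psi> (t, x)) \<in> borel_measurable ?M" if "\<psi> \<in> borel_measurable borel"
    for \<psi> :: "'b \<times> 'a \<Rightarrow> real" and t
  proof -
    have "(\<lambda>x. \<psi> (t, x)) \<in> borel_measurable borel" using that by simp
    then show ?thesis by (intro measurable_restrict_space1 measurable_completion) simp
  qed
  have slice_int: "integrable ?M (\<lambda>x. \<psi> (t, x))"
    if "\<psi> \<in> borel_measurable borel" "\<And>z. \<bar>\<psi> z\<bar> \<le> C" for \<psi> :: "'b \<times> 'a \<Rightarrow> real" and C t
    using that by (intro M.integrable_const_bound[of _ C]) (auto intro!: slice_meas)
  have slice_bound: "\<bar>\<integral>x. \<psi> (t, x) \<partial>?M\<bar> \<le> C * measure ?M (space ?M)"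
    if "\<psi> \<in> borel_measurable borel" "\<And>z. \<bar>\<psi> z\<bar> \<le> C" for \<psi> :: "'b \<times> 'a \<Rightarrow> real" and C t
  proof -
    have "\<bar>\<integral>x. \<psi> (t, x) \<partial>?M\<bar> \<le> (\<integral>x. \<bar>\<psi> (t, x)\<bar> \<partial>?M)"
      by (rule integral_abs_bound)
    also have "\<dots> \<le> (\<integral>x. C \<partial>?M)"
      using that by (intro integral_mono integrable_abs slice_int) auto
    finally show ?thesis by (simp add: mult.commute)
  qed
  have r_abs: "\<bar>r k z\<bar> \<le> b" for k z
    using r(2)[of k z] r(3)[of k z] ab by auto

  have lim: "\<exists>H \<in> borel_measurable ?L. integrable ?L H \<and>
      (AE t in ?L. H t = L2_inner \<Omega> (R t) (\<lambda>x. \<psi> (t, x))) \<and>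
      (\<lambda>k. \<integral>z. r k z * \<psi> z \<partial>?Q) \<longlonglongrightarrow> (\<integral>t. H t \<partial>?L)"
    if \<psi>: "\<psi> \<in> borel_measurable borel" "\<And>z. \<bar>\<psi> z\<bar> \<le> C" for \<psi> :: "'b \<times> 'a \<Rightarrow> real" and C
  proof -
    define h where "h k t = (\<integral>x. r k (t, x) * \<psi> (t, x) \<partial>?M)" for k t
    define H where "H t = lim (\<lambda>k. h k t)" for t
    define B where "B = b * C * measure ?M (space ?M)"
    have r\<psi>: "(\<lambda>z. r k z * \<psi> z) \<in> borel_measurable borel" for k
      using r(1) \<psi>(1) by simp
    have r\<psi>_bound: "\<bar>r k z * \<psi> z\<bar> \<le> b * C" for k z
      using mult_mono[OF r_abs \<psi>(2)] ab by (simp add: abs_mult)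
    have h_meas: "h k \<in> borel_measurable ?L" for k
    proof -
      have "h k \<in> borel_measurable borel"
        using borel_measurable_slice_integral[OF \<Omega>_borel r\<psi>] by (simp add: h_def[abs_def])
      then show ?thesis by (intro measurable_restrict_space1) simp
    qed
    have h_bound: "\<bar>h k t\<bar> \<le> B" for k t
      using slice_bound[OF r\<psi> r\<psi>_bound] by (simp add: h_def B_def)
    have H_meas: "H \<in> borel_measurable ?L"
      unfolding H_def using h_meas by (rule borel_measurable_lim_metric)
    have h_lim: "AE t in ?L. (\<lambda>k. h k t) \<longlonglongrightarrow> L2_inner \<Omega> (R t) (\<lambda>x. \<psi> (t, x))"
      using slices
    proof eventually_elim
      case (elim t)
      then show ?case
        using slice_int[OF \<psi>, of t] by (simp add: h_def L2_inner_def)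
    qed
    then have H_eq: "AE t in ?L. H t = L2_inner \<Omega> (R t) (\<lambda>x. \<psi> (t, x))"
      by eventually_elim (simp add: H_def limI)
    have h_H: "AE t in ?L. (\<lambda>k. h k t) \<longlonglongrightarrow> H t"
      using h_lim H_eq by eventually_elim simp
    have "(\<lambda>k. \<integral>t. h k t \<partial>?L) \<longlonglongrightarrow> (\<integral>t. H t \<partial>?L)"
      by (rule integral_dominated_convergence[where w = "\<lambda>_. B"])
         (use h_meas H_meas h_H h_bound in auto)
    moreover have "integrable ?L H"
      by (rule integrable_dominated_convergence[where w = "\<lambda>_. B" and s = h])
         (use h_meas H_meas h_H h_bound in auto)
    moreover have "(\<integral>z. r k z * \<psi> z \<partial>?Q) = (\<integral>t. h k t \<partial>?L)" for k
      unfolding h_def by (rule integral_restrict_lborel_Times[OF S \<Omega>(1) \<Omega>_borel r\<psi> r\<psi>_bound])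
    ultimately show ?thesis
      using H_meas H_eq by auto
  qed

  obtain g0 where g0: "g0 \<in> borel_measurable ?Q" "\<And>z. a \<le> g0 z" "\<And>z. g0 z \<le> b"
    "\<And>\<psi>. integrable ?Q \<psi> \<Longrightarrow> (\<lambda>k. \<integral>z. r k z * \<psi> z \<partial>?Q) \<longlonglongrightarrow> (\<integral>z. g0 z * \<psi> z \<partial>?Q)"
  proof (rule bounded_weak_limit_exists[OF fin_Q ab, of r])
    show "r k \<in> borel_measurable ?Q" for k
      using r(1) by (intro measurable_restrict_space1) simp
    show "AE z in ?Q. a \<le> r k z \<and> r k z \<le> b" for k
      using r by simp
    fix A assume "A \<in> sets ?Q"
    then have "A \<in> sets borel"
      using Q_borel by (simp add: sets_restrict_space_iff)
    then have "indicator A \<in> borel_measurable borel" by simp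
    from lim[OF this, of 1] show "convergent (\<lambda>k. \<integral>z. r k z * indicator A z \<partial>?Q)"
      by (auto simp: indicator_def convergent_def)
  qed blast
  \<comment> \<open>\<open>g0\<close> is measurable on the product set only\<close>
  define g where "g z = (if z \<in> S \<times> \<Omega> then g0 z else a)" for z
  have g_meas: "g \<in> borel_measurable borel"
  proof -
    have "g \<in> borel_measurable lborel"
      unfolding g_def using g0(1) Q_borel
      by (subst measurable_If_restrict_space_iff) (auto simp del: mem_Times_iff)
    then show ?thesis by simp
  qed
  have g_bounds: "a \<le> g z" "g z \<le> b" for z
    using g0 ab by (auto simp: g_def)
  have g_abs: "\<bar>g z\<bar> \<le> b" for z
    using g_bounds[of z] ab by auto
  have g_lim: "(\<lambda>k. \<integral>z. r k z * \<psi> z \<partial>?Q) \<longlonglongrightarrow> (\<integral>z. g z * \<psi> z \<partial>?Q)" if "integrable ?Q \<psi>" for \<psi>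
  proof -
    have "(\<integral>z. g z * \<psi> z \<partial>?Q) = (\<integral>z. g0 z * \<psi> z \<partial>?Q)"
      by (intro Bochner_Integration.integral_cong) (auto simp: g_def space_restrict_space)
    then show ?thesis using g0(4)[OF that] by simp
  qed

  have "AE t in ?L. L2_inner \<Omega> (\<lambda>x. g (t, x)) \<phi> = L2_inner \<Omega> (R t) \<phi>" if \<phi>: "\<phi> \<in> bumps \<Omega>" for \<phi>
  proof -
    define G where "G t = (\<integral>x. g (t, x) * \<phi> x \<partial>?M)" for t
    have \<phi>_meas: "(\<lambda>z::'b \<times> 'a. \<phi> (snd z)) \<in> borel_measurable borel"
      by (rule measurable_compose[OF _ borel_measurable_bumps[OF \<phi>]])
         (intro borel_measurable_continuous_onI continuous_intros)
    have g\<phi>: "(\<lambda>z. g z * \<phi> (snd z)) \<in> borel_measurable borel"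
      using g_meas \<phi>_meas by simp
    have g\<phi>_bound: "\<bar>g z * \<phi> (snd z)\<bar> \<le> b * 1" for z
      unfolding abs_mult using g_abs abs_bumps_le_1[OF \<phi>] ab by (intro mult_mono) auto
    have "G \<in> borel_measurable borel"
      using borel_measurable_slice_integral[OF \<Omega>_borel g\<phi>] by (simp add: G_def[abs_def])
    then have G_meas: "G \<in> borel_measurable ?L"
      by (intro measurable_restrict_space1) simp
    have "\<bar>G t\<bar> \<le> b * 1 * measure ?M (space ?M)" for t
      using slice_bound[OF g\<phi> g\<phi>_bound] by (simp add: G_def)
    then have G_int: "integrable ?L G"
      using G_meas by (intro L.integrable_const_bound) auto
    obtain H where H: "H \<in> borel_measurable ?L" "integrable ?L H"
      "AE t in ?L. H t = L2_inner \<Omega> (R t) (\<lambda>x. \<phi> (snd (t, x)))"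
      using lim[OF \<phi>_meas abs_bumps_le_1[OF \<phi>]] by blast
    have "AE t in ?L. G t = H t"
    proof (rule AE_eq_if_integrals_eq[OF G_int H(2)])
      fix J assume J: "J \<in> sets ?L"
      then have J_borel: "J \<in> sets borel"
        using S by (simp add: sets_restrict_space_iff)
      let ?\<psi> = "\<lambda>z::'b \<times> 'a. indicator J (fst z) * \<phi> (snd z)"
      have \<psi>_meas: "?\<psi> \<in> borel_measurable borel"
      proof (rule borel_measurable_times[OF _ \<phi>_meas])
        have "fst \<in> borel_measurable (borel :: ('b \<times> 'a) measure)"
          by (intro borel_measurable_continuous_onI continuous_intros)
        then show "(\<lambda>z::'b \<times> 'a. indicator J (fst z) :: real) \<in> borel_measurable borel"
          using J_borel by (auto intro: measurable_compose)
      qed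
      have \<psi>_bound: "\<bar>?\<psi> z\<bar> \<le> 1" for z
        using abs_bumps_le_1[OF \<phi>] by (simp add: indicator_def)
      have pull: "y * (indicator J t * \<phi> x) = indicator J t * (y * \<phi> x)" for y t x
        by (rule mult.left_commute)
      obtain K where K: "K \<in> borel_measurable ?L" "AE t in ?L. K t = L2_inner \<Omega> (R t) (\<lambda>x. ?\<psi> (t, x))"
        "(\<lambda>k. \<integral>z. r k z * ?\<psi> z \<partial>?Q) \<longlonglongrightarrow> (\<integral>t. K t \<partial>?L)"
        using lim[OF \<psi>_meas \<psi>_bound] by blast
      have "integrable ?Q ?\<psi>"
        using \<psi>_meas \<psi>_bound
        by (intro Q.integrable_const_bound[of _ 1] measurable_restrict_space1) auto
      then have "(\<lambda>k. \<integral>z. r k z * ?\<psi> z \<partial>?Q) \<longlonglongrightarrow> (\<integral>z. g z * ?\<psi> z \<partial>?Q)"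
        by (rule g_lim)
      with K(3) have "(\<integral>t. K t \<partial>?L) = (\<integral>z. g z * ?\<psi> z \<partial>?Q)"
        by (rule LIMSEQ_unique)
      also have "\<dots> = (\<integral>t. (\<integral>x. g (t, x) * ?\<psi> (t, x) \<partial>?M) \<partial>?L)"
      proof (rule integral_restrict_lborel_Times[OF S \<Omega>(1) \<Omega>_borel])
        show "(\<lambda>z. g z * ?\<psi> z) \<in> borel_measurable borel"
          using g_meas \<psi>_meas by simp
        show "\<bar>g z * ?\<psi> z\<bar> \<le> b * 1" for z
          unfolding abs_mult[of "g z"] using g_abs \<psi>_bound ab by (intro mult_mono) auto
      qed
      also have "\<dots> = (\<integral>t. G t * indicator J t \<partial>?L)"
        unfolding fst_conv snd_conv pull by (simp add: G_def mult.commute)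
      finally have "(\<integral>t. G t * indicator J t \<partial>?L) = (\<integral>t. K t \<partial>?L)" ..
      also have "\<dots> = (\<integral>t. H t * indicator J t \<partial>?L)"
      proof (rule integral_cong_AE)
        show "AE t in ?L. K t = H t * indicator J t"
          using K(2) H(3) by eventually_elim (simp add: L2_inner_def pull mult.commute[of _ "indicator J _"])
      qed (use K H J in auto)
      finally show "(\<integral>t. G t * indicator J t \<partial>?L) = (\<integral>t. H t * indicator J t \<partial>?L)" .
    qed
    with H(3) show ?thesis
      by eventually_elim (simp add: G_def L2_inner_def)
  qed
  then have "AE t in ?L. \<forall>\<phi>\<in>bumps \<Omega>. L2_inner \<Omega> (\<lambda>x. g (t, x)) \<phi> = L2_inner \<Omega> (R t) \<phi>"
    by (subst AE_ball_countable[OF countable_bumps]) blast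
  moreover have "AE t in ?L. t \<in> S"
    using AE_space[of ?L] by (simp add: space_restrict_space)
  ultimately have "AE t in ?L. AE x in ?M. g (t, x) = R t x"
  proof eventually_elim
    case (elim t)
    show ?case
    proof (rule AE_eq_if_bump_integrals_eq[OF \<Omega>(2)])
      show "integrable ?M (\<lambda>x. g (t, x))"
        by (rule slice_int[OF g_meas g_abs])
      have "\<bar>R t x\<bar> \<le> b" for x
        using R(2,3)[OF elim(2), of x] ab by auto
      then show "integrable ?M (R t)"
        using R(1)[OF elim(2)] by (intro M.integrable_const_bound[of _ b]) auto
    qed (use elim in auto)
  qed
  with g_meas g_bounds show ?thesis
    by (rule that)
qed

text \<open>
  The slices \<open>R t\<close> of the limit exist for every \<open>t\<close>, but only \<open>g\<close> is known to be jointly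
  measurable; \<open>\<rho>'\<close> combines the two.
\<close>

lemma weak_compactness_of_weakly_equicontinuous_sequences:
  fixes \<Omega> :: "'a::euclidean_space set" and \<rho> :: "nat \<Rightarrow> real \<Rightarrow> 'a \<Rightarrow> real"
  assumes \<Omega>: "bounded \<Omega>" "open \<Omega>" and "T > 0" and \<alpha>\<beta>: "0 \<le> \<alpha>" "\<alpha> \<le> \<beta>"
    and L2_valued: "\<And>k t. t \<in> {0..T} \<Longrightarrow> \<rho> k t \<in> L2 \<Omega>"
    and mem: "\<And>k. \<rho> k \<in> Linf_Linf T \<Omega>"
    and bounds: "\<And>k. AE (t, x) in lebesgue_on ({0..T} \<times> \<Omega>). \<alpha> \<le> \<rho> k t x \<and> \<rho> k t x \<le> \<beta>"
    and equicont: "\<And>\<phi>. \<phi> \<in> test_functions \<Omega> \<Longrightarrow>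
               equicontinuous_family_on {0..T} (\<lambda>k t. L2_inner \<Omega> (\<rho> k t) \<phi>)"
  obtains \<sigma> :: "nat \<Rightarrow> nat" and \<rho>' where "strict_mono \<sigma>" "\<rho>' \<in> Linf_Linf T \<Omega>"
    "AE (t, x) in lebesgue_on ({0..T} \<times> \<Omega>). \<alpha> \<le> \<rho>' t x \<and> \<rho>' t x \<le> \<beta>"
    "\<And>t. t \<in> {0..T} \<Longrightarrow> weakly_converges_L2 \<Omega> (\<lambda>k. \<rho> (\<sigma> k) t) (\<rho>' t)"
proof -
  let ?I = "{0..T}" and ?M = "lebesgue_on \<Omega>"
  let ?L = "restrict_space lborel ?I" and ?Q = "lebesgue_on (?I \<times> \<Omega>)"
  have \<Omega>_borel: "\<Omega> \<in> sets borel" using \<Omega> by simp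
  have I: "bounded ?I" "?I \<in> sets borel" by auto
  have Q_borel: "?I \<times> \<Omega> \<in> sets borel" using \<Omega>_borel by (simp add: borel_Times)
  have fin: "finite_measure ?M"
    using \<Omega> by (intro finite_measure_lebesgue_on lmeasurable_open)
  interpret finite_measure ?M by fact
  have \<rho>_int: "integrable ?M (\<rho> k t)" if "t \<in> ?I" for k t
    using L2_imp_integrable[OF fin L2_valued[OF that]] .
  have bump_equicont: "equicontinuous_family_on ?I (\<lambda>k t. L2_inner \<Omega> (\<rho> k t) \<phi>)"
    if "\<phi> \<in> bumps \<Omega>" for \<phi>
    using equicont bumps_subset_test_functions that by blast

  have \<rho>_bounds: "AE x in ?M. \<alpha> \<le> \<rho> k t x \<and> \<rho> k t x \<le> \<beta>" if "t \<in> ?I" for k t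
  proof (rule bounds_at_every_time[OF \<Omega>(2) fin \<alpha>\<beta> \<open>T > 0\<close> \<rho>_int[of _ k] _ _ that])
    show "AE t in ?L. AE x in ?M. \<alpha> \<le> \<rho> k t x \<and> \<rho> k t x \<le> \<beta>"
      using AE_lebesgue_on_Times_slices[OF I(2) \<Omega>_borel bounds[of k]] by simp
    show "continuous_on ?I (\<lambda>t. L2_inner \<Omega> (\<rho> k t) \<phi>)" if "\<phi> \<in> bumps \<Omega>" for \<phi>
      using equicontinuous_imp_continuous[OF bump_equicont[OF that]] by simp
  qed

  obtain D where D: "countable D" "D \<subseteq> ?I" "?I \<subseteq> closure D"
    using separable by blast
  have pairing_bound: "norm (L2_inner \<Omega> (\<rho> k t) \<phi>) \<le> \<beta> * measure ?M (space ?M)"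
    if "t \<in> ?I" "\<phi> \<in> bumps \<Omega>" for k t \<phi>
  proof -
    have "AE x in ?M. \<bar>\<rho> k t x\<bar> \<le> \<beta>"
      using \<rho>_bounds[OF that(1), of k] by eventually_elim (use \<alpha>\<beta> in auto)
    then have "norm (L2_inner \<Omega> (\<rho> k t) \<phi>) \<le> \<beta> * (\<integral>x. \<bar>\<phi> x\<bar> \<partial>?M)"
      using integral_bounded_mult_le[OF integrable_bumps[OF fin that(2)]] \<rho>_int[OF that(1)]
      by (auto simp: L2_inner_def)
    also have "(\<integral>x. \<bar>\<phi> x\<bar> \<partial>?M) \<le> (\<integral>x. 1 \<partial>?M)"
      by (intro integral_mono integrable_abs integrable_bumps[OF fin that(2)] abs_bumps_le_1[OF that(2)]) simp
    finally show ?thesis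
      using \<alpha>\<beta> by (simp add: mult_left_mono)
  qed
  obtain \<sigma> where \<sigma>: "strict_mono \<sigma>"
    "\<And>p. p \<in> D \<times> bumps \<Omega> \<Longrightarrow> \<exists>l. (\<lambda>k. L2_inner \<Omega> (\<rho> (\<sigma> k) (fst p)) (snd p)) \<longlonglongrightarrow> l"
  proof (rule function_convergent_subsequence[of "D \<times> bumps \<Omega>" "\<lambda>k p. L2_inner \<Omega> (\<rho> k (fst p)) (snd p)"])
    show "countable (D \<times> bumps \<Omega>)" using D(1) countable_bumps by blast
    show "norm (L2_inner \<Omega> (\<rho> k (fst p)) (snd p)) \<le> \<beta> * measure ?M (space ?M)"
      if "p \<in> D \<times> bumps \<Omega>" for k p
      using that D(2) by (intro pairing_bound) auto
  qed blast
  define v where "v k = \<rho> (\<sigma> k)" for k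
  have v_conv: "convergent (\<lambda>k. L2_inner \<Omega> (v k t) \<phi>)" if t: "t \<in> ?I" and \<phi>: "\<phi> \<in> bumps \<Omega>" for t \<phi>
  proof (rule equicontinuous_convergent[OF _ D(2,3) _ t])
    show "equicontinuous_family_on ?I (\<lambda>k t. L2_inner \<Omega> (v k t) \<phi>)"
      using equicontinuous_subfamily[OF bump_equicont[OF \<phi>], of \<sigma>] by (simp add: v_def)
    show "convergent (\<lambda>k. L2_inner \<Omega> (v k s) \<phi>)" if "s \<in> D" for s
      using \<sigma>(2)[of "(s, \<phi>)"] that \<phi> by (auto simp: convergent_def v_def)
  qed
  have "\<exists>g. g \<in> borel_measurable ?M \<and> (\<forall>x. \<alpha> \<le> g x \<and> g x \<le> \<beta>) \<and>
      (\<forall>\<psi>. integrable ?M \<psi> \<longrightarrow> (\<lambda>k. L2_inner \<Omega> (v k t) \<psi>) \<longlonglongrightarrow> L2_inner \<Omega> g \<psi>)"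
    if t: "t \<in> ?I" for t
  proof (rule weak_limit_if_bump_integrals_converge[OF \<Omega>(2) fin \<alpha>\<beta>, of "\<lambda>k. v k t"])
    show "v k t \<in> borel_measurable ?M" for k
      using \<rho>_int[OF t] by (auto simp: v_def)
  qed (use \<rho>_bounds[OF t] v_conv[OF t] in \<open>auto simp: v_def\<close>)
  then have "\<forall>t\<in>?I. \<exists>g. g \<in> borel_measurable ?M \<and> (\<forall>x. \<alpha> \<le> g x \<and> g x \<le> \<beta>) \<and>
      (\<forall>\<psi>. integrable ?M \<psi> \<longrightarrow> (\<lambda>k. L2_inner \<Omega> (v k t) \<psi>) \<longlonglongrightarrow> L2_inner \<Omega> g \<psi>)"
    by (rule ballI)
  from bchoice[OF this] obtain R where "\<forall>t\<in>?I. R t \<in> borel_measurable ?M \<and> (\<forall>x. \<alpha> \<le> R t x \<and> R t x \<le> \<beta>) \<and>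
      (\<forall>\<psi>. integrable ?M \<psi> \<longrightarrow> (\<lambda>k. L2_inner \<Omega> (v k t) \<psi>) \<longlonglongrightarrow> L2_inner \<Omega> (R t) \<psi>)"
    ..
  then have R: "\<And>t. t \<in> ?I \<Longrightarrow> R t \<in> borel_measurable ?M"
    "\<And>t x. t \<in> ?I \<Longrightarrow> \<alpha> \<le> R t x" "\<And>t x. t \<in> ?I \<Longrightarrow> R t x \<le> \<beta>"
    "\<And>t \<psi>. t \<in> ?I \<Longrightarrow> integrable ?M \<psi> \<Longrightarrow> (\<lambda>k. L2_inner \<Omega> (v k t) \<psi>) \<longlonglongrightarrow> L2_inner \<Omega> (R t) \<psi>"
    by blast+

  have "\<exists>r. r \<in> borel_measurable borel \<and> (\<forall>z. \<alpha> \<le> r z \<and> r z \<le> \<beta>) \<and>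
      (AE t in ?L. AE x in ?M. v k t x = r (t, x))" for k
  proof -
    have "(\<lambda>(t, x). v k t x) \<in> borel_measurable ?Q"
      using mem by (simp add: Linf_Linf_def Linf_def v_def)
    moreover have "AE z in ?Q. \<alpha> \<le> (\<lambda>(t, x). v k t x) z \<and> (\<lambda>(t, x). v k t x) z \<le> \<beta>"
      using bounds[of "\<sigma> k"] by eventually_elim (auto simp: v_def)
    ultimately obtain r where r: "r \<in> borel_measurable borel" "\<And>z. \<alpha> \<le> r z" "\<And>z. r z \<le> \<beta>"
      "AE z in ?Q. (\<lambda>(t, x). v k t x) z = r z"
      using bounded_borel_representative[OF Q_borel _ \<alpha>\<beta>(2)] by blast
    from AE_lebesgue_on_Times_slices[OF I(2) \<Omega>_borel r(4)] r(1-3) show ?thesis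
      by auto
  qed
  then have "\<forall>k. \<exists>r. r \<in> borel_measurable borel \<and> (\<forall>z. \<alpha> \<le> r z \<and> r z \<le> \<beta>) \<and>
      (AE t in ?L. AE x in ?M. v k t x = r (t, x))" ..
  from choice[OF this] obtain r where "\<forall>k. r k \<in> borel_measurable borel \<and> (\<forall>z. \<alpha> \<le> r k z \<and> r k z \<le> \<beta>) \<and>
      (AE t in ?L. AE x in ?M. v k t x = r k (t, x))" ..
  then have r: "\<And>k. r k \<in> borel_measurable borel" "\<And>k z. \<alpha> \<le> r k z" "\<And>k z. r k z \<le> \<beta>"
    "\<And>k. AE t in ?L. AE x in ?M. v k t x = r k (t, x)"
    by blast+
  have t_in: "AE t in ?L. t \<in> ?I"
    using AE_space[of ?L] by (simp add: space_restrict_space)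
  have slices: "AE t in ?L. \<forall>\<psi>. integrable ?M \<psi> \<longrightarrow>
      (\<lambda>k. L2_inner \<Omega> (\<lambda>x. r k (t, x)) \<psi>) \<longlonglongrightarrow> L2_inner \<Omega> (R t) \<psi>"
  proof -
    have "AE t in ?L. \<forall>k. AE x in ?M. v k t x = r k (t, x)"
      using r(4) by (simp add: AE_all_countable)
    with t_in show ?thesis
    proof eventually_elim
      case (elim t)
      show ?case
      proof (intro allI impI)
        fix \<psi> :: "'a \<Rightarrow> real" assume \<psi>: "integrable ?M \<psi>"
        have "L2_inner \<Omega> (v k t) \<psi> = L2_inner \<Omega> (\<lambda>x. r k (t, x)) \<psi>" for k
        proof (rule L2_inner_cong_AE)
          show "v k t \<in> borel_measurable ?M"
            using \<rho>_int[OF elim(1)] by (auto simp: v_def)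
          have "(\<lambda>x. r k (t, x)) \<in> borel_measurable borel"
            using r(1)[of k] by simp
          then show "(\<lambda>x. r k (t, x)) \<in> borel_measurable ?M"
            by (intro measurable_restrict_space1 measurable_completion) simp
        qed (use elim \<psi> in auto)
        with R(4)[OF elim(1) \<psi>] show "(\<lambda>k. L2_inner \<Omega> (\<lambda>x. r k (t, x)) \<psi>) \<longlonglongrightarrow> L2_inner \<Omega> (R t) \<psi>"
          by simp
      qed
    qed
  qed
  obtain g where g: "g \<in> borel_measurable borel" "\<And>z. \<alpha> \<le> g z" "\<And>z. g z \<le> \<beta>"
    "AE t in ?L. AE x in ?M. g (t, x) = R t x"
    using jointly_measurable_weak_limit[OF I \<Omega> \<alpha>\<beta> r(1-3) R(1-3) slices] by blast

  \<comment> \<open>at a time that is not good, \<open>R t\<close> replaces the slice of \<open>g\<close>; these times form a null set\<close>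
  define good where "good t \<longleftrightarrow> (AE x in ?M. g (t, x) = R t x)" for t
  define \<rho>' where "\<rho>' t x = (if good t then g (t, x) else R t x)" for t x
  have \<rho>'_eq_g: "AE z in ?Q. g z = (\<lambda>(t, x). \<rho>' t x) z"
  proof -
    have "AE z in ?Q. good (fst z)"
      using AE_slices_imp_AE_lebesgue_on_Times[OF I(2) \<Omega>_borel] g(4) by (simp add: good_def)
    then show ?thesis
      by eventually_elim (auto simp: \<rho>'_def)
  qed
  have \<rho>'_bounds: "AE (t, x) in ?Q. \<alpha> \<le> \<rho>' t x \<and> \<rho>' t x \<le> \<beta>"
    using \<rho>'_eq_g
  proof eventually_elim
    case (elim z)
    with g(2,3)[of z] show ?case by (cases z) auto
  qed
  have "\<rho>' \<in> Linf_Linf T \<Omega>"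
  proof -
    have "(\<lambda>z. indicator (?I \<times> \<Omega>) z *\<^sub>R g z) \<in> borel_measurable lebesgue"
      using g(1) Q_borel by (intro measurable_completion) simp
    moreover have "AE z in lebesgue. indicator (?I \<times> \<Omega>) z *\<^sub>R g z =
        indicator (?I \<times> \<Omega>) z *\<^sub>R (\<lambda>(t, x). \<rho>' t x) z"
      using \<rho>'_eq_g Q_borel
      by (subst (asm) AE_restrict_space_iff) (auto simp: indicator_def elim!: eventually_mono)
    ultimately have "(\<lambda>z. indicator (?I \<times> \<Omega>) z *\<^sub>R (\<lambda>(t, x). \<rho>' t x) z) \<in> borel_measurable lebesgue"
      by (rule borel_measurable_AE)
    then have "(\<lambda>(t, x). \<rho>' t x) \<in> borel_measurable ?Q"
      using Q_borel by (subst borel_measurable_restrict_space_iff) auto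
    moreover have "AE z in ?Q. \<bar>(\<lambda>(t, x). \<rho>' t x) z\<bar> \<le> \<beta>"
      using \<rho>'_bounds by eventually_elim (use \<alpha>\<beta> in auto)
    ultimately show ?thesis
      by (auto simp: Linf_Linf_def Linf_def)
  qed
  moreover have "weakly_converges_L2 \<Omega> (\<lambda>k. \<rho> (\<sigma> k) t) (\<rho>' t)" if t: "t \<in> ?I" for t
  proof -
    have "(\<lambda>x. g (t, x)) \<in> borel_measurable borel"
      using g(1) by simp
    then have "(\<lambda>x. g (t, x)) \<in> borel_measurable ?M"
      by (intro measurable_restrict_space1 measurable_completion) simp
    then have \<rho>'_meas: "\<rho>' t \<in> borel_measurable ?M"
      using R(1)[OF t] by (cases "good t") (simp_all add: \<rho>'_def[abs_def])
    have "\<bar>\<rho>' t x\<bar> \<le> \<beta>" for x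
      using g(2,3)[of "(t, x)"] R(2,3)[OF t, of x] \<alpha>\<beta> by (auto simp: \<rho>'_def)
    then have "\<rho>' t \<in> L2 \<Omega>"
      by (rule bounded_imp_L2[OF fin \<rho>'_meas])
    moreover have "AE x in ?M. R t x = \<rho>' t x"
      by (cases "good t") (auto simp: \<rho>'_def good_def elim!: eventually_mono)
    then have "(\<lambda>k. L2_inner \<Omega> (\<rho> (\<sigma> k) t) \<psi>) \<longlonglongrightarrow> L2_inner \<Omega> (\<rho>' t) \<psi>" if "\<psi> \<in> L2 \<Omega>" for \<psi>
      using R(4)[OF t L2_imp_integrable[OF fin that]]
        L2_inner_cong_AE[OF R(1)[OF t] \<rho>'_meas, of \<psi>] that
      by (simp add: v_def L2_def)
    ultimately show ?thesis
      using L2_valued[OF t] by (auto simp: weakly_converges_L2_def)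
  qed
  ultimately show ?thesis
    using that[OF \<sigma>(1) _ \<rho>'_bounds] by blast
qed

theorem lemma1p1:
  fixes \<Omega> :: "(real^3) set" and T \<alpha> \<beta> :: real
    and \<rho> :: "nat \<Rightarrow> real \<Rightarrow> real^3 \<Rightarrow> real"
  assumes "bounded \<Omega>" and "connected \<Omega>" and "open \<Omega>" and "Ck_boundary 4 \<Omega>"
    and "T > 0" and "0 < \<alpha>" and "\<alpha> \<le> \<beta>"
    and L2_valued: "\<And>k t. t \<in> {0..T} \<Longrightarrow> \<rho> k t \<in> L2 \<Omega>"
    and A1_mem: "\<And>k. \<rho> k \<in> Linf_Linf T \<Omega>"
    and A1_bounds: "\<And>k. AE (t, x) in lebesgue_on ({0..T} \<times> \<Omega>). \<alpha> \<le> \<rho> k t x \<and> \<rho> k t x \<le> \<beta>"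
    and A2: "\<And>\<phi>. \<phi> \<in> test_functions \<Omega> \<Longrightarrow>
               equicontinuous_family_on {0..T} (\<lambda>k t. L2_inner \<Omega> (\<rho> k t) \<phi>)"
  shows "\<exists>\<sigma> :: nat \<Rightarrow> nat. strict_mono \<sigma> \<and>
           (\<exists>\<rho>' \<in> Linf_Linf T \<Omega>.
              (AE (t, x) in lebesgue_on ({0..T} \<times> \<Omega>). \<alpha> \<le> \<rho>' t x \<and> \<rho>' t x \<le> \<beta>) \<and>
              (\<forall>t\<in>{0..T}. weakly_converges_L2 \<Omega> (\<lambda>k. \<rho> (\<sigma> k) t) (\<rho>' t)))"
proof -
  obtain \<sigma> \<rho>' where "strict_mono \<sigma>" "\<rho>' \<in> Linf_Linf T \<Omega>"
    "AE (t, x) in lebesgue_on ({0..T} \<times> \<Omega>). \<alpha> \<le> \<rho>' t x \<and> \<rho>' t x \<le> \<beta>"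
    "\<And>t. t \<in> {0..T} \<Longrightarrow> weakly_converges_L2 \<Omega> (\<lambda>k. \<rho> (\<sigma> k) t) (\<rho>' t)"
    using weak_compactness_of_weakly_equicontinuous_sequences[OF \<open>bounded \<Omega>\<close> \<open>open \<Omega>\<close> \<open>T > 0\<close>
        less_imp_le[OF \<open>0 < \<alpha>\<close>] \<open>\<alpha> \<le> \<beta>\<close> L2_valued A1_mem A1_bounds A2]
    by blast
  then show ?thesis
    by blast
qed

end
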